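(* Let $b\ge 2$ be an integer, let $\lambda>0$, and let $A\subset\mathbb{R}$, $A\notin\{\emptyset,\mathbb{R}\}$, be a finite union of $r_A\ge1$ pairwise disjoint intervals with endpoints $-\infty\le a_j<b_j\le\infty$. With notation as in the context, for every $\alpha>0$ and every $p\in(\nu(A),M_A)$ the following assertions are equivalent: (i) $Q_A(p+)=Q_A(p)$; (ii) $\rho_{\alpha,A}(p)=0$; (iii) there exist $h_p\in\mathcal{O}_A(p)$ and a sequence $\{h_n\}_{n\ge1}\subset\mathcal{U}_A(p)$ such that $\lim_{n\to\infty}\|h_n-h_p\|_{\ell^\alpha}=0$.
   Context: $\nu$ is the standard Gaussian measure on $\mathbb{R}$; $g_A(x)=\nu(A-x)$ with $A-x=\{a-x:a\in A\}$; $M_A=\sup_{x\in\mathbb{R}}g_A(x)$. $\mathbb{T}_b=\bigcup_{k\ge0}\{1,\dots,b\}^k$ is the rooted $b$-ary tree with root $\varnothing$; $|v|$ is the length of $v$. $\mathcal{H}_b$ is the set of real fields $h=(h_v)_{v\in\mathbb{T}_b}$ with $h_\varnothing=0$ and $\|h\|_b:=\sum_{k\ge1}b^{-k}\sum_{|v|=k}|h_v|<\infty$. $\partial\mathbb{T}_b=\{1,\dots,b\}^{\{1,2,\dots\}}$ carries the product $\sigma$-algebra and the product measure $\mathbf{m}_b$ of uniform measures on $\{1,\dots,b\}$; $\xi|k$ is the vector of the first $k$ coordinates of $\xi$. For $h\in\mathcal{H}_b$, $H_h(\xi)=\sum_{k\ge1}h_{\xi|k}$ (absolutely convergent for $\mathbf{m}_b$-a.e.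 $\xi$), $\Psi_A(h)=\int_{\partial\mathbb{T}_b}g_A(H_h(\xi))\,\mathbf{m}_b(d\xi)$, $\mathcal{I}_\alpha(h)=\lambda\sum_{v\ne\varnothing}|h_v|^\alpha\in[0,\infty]$, and $Q_A(q)=\inf\{\mathcal{I}_\alpha(h):h\in\mathcal{H}_b,\ \Psi_A(h)=q\}$ for $q\in[0,1]$, with $\inf\emptyset=\infty$. $Q_A$ is strictly increasing on $[\nu(A),M_A)$, and $Q_A(p+):=\lim_{q\downarrow p}Q_A(q)$. For $h\in\mathcal{H}_b$, $\|h\|_{\ell^\alpha}=\big(\sum_{v\ne\varnothing}|h_v|^\alpha\big)^{1/\alpha}\in[0,\infty]$ (a quasi-norm if $0<\alpha<1$). For $p\in(\nu(A),M_A)$: $\mathcal{O}_A(p)=\{h\in\mathcal{H}_b:\Psi_A(h)=p,\ \mathcal{I}_\alpha(h)=Q_A(p)\}$; $\mathcal{U}_A(p)=\{h\in\mathcal{H}_b:\mathcal{I}_\alpha(h)<\infty,\ \Psi_A(h)>p\}$; $\rho_{\alpha,A}(p)=\inf\{\|\widetilde h-h\|_{\ell^\alpha}:h\in\mathcal{O}_A(p),\ \widetilde h\in\mathcal{U}_A(p)\}$ (both sets are nonempty). *)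

theory Defs
  imports "HOL-Probability.Probability"
begin

(* Each endpoint may or may not belong to the interval. *)
definition interval_with_endpoints :: "ereal \<Rightarrow> ereal \<Rightarrow> real set \<Rightarrow> bool" where
  "interval_with_endpoints a b I \<longleftrightarrow>
     {x. a < ereal x \<and> ereal x < b} \<subseteq> I \<and> I \<subseteq> {x. a \<le> ereal x \<and> ereal x \<le> b}"

definition shift_set :: "real set \<Rightarrow> real \<Rightarrow> real set" where
  "shift_set A x = {a - x | a. a \<in> A}"

definition gauss_prob :: "real set \<Rightarrow> real" where
  "gauss_prob A = measure std_normal_distribution A"

definition g_fun :: "real set \<Rightarrow> real \<Rightarrow> real" where
  "g_fun A x = gauss_prob (shift_set A x)"

definition M_sup :: "real set \<Rightarrow> real" where
  "M_sup A = (SUP x. g_fun A x)"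

definition tree :: "nat \<Rightarrow> nat list set" where
  "tree b = {v. set v \<subseteq> {1..b}}"

definition tree_level :: "nat \<Rightarrow> nat \<Rightarrow> nat list set" where
  "tree_level b k = {v \<in> tree b. length v = k}"

definition field_norm :: "nat \<Rightarrow> (nat list \<Rightarrow> real) \<Rightarrow> ennreal" where
  "field_norm b h =
     (\<Sum>k. ennreal ((\<Sum>v\<in>tree_level b (Suc k). \<bar>h v\<bar>) / real b ^ Suc k))"

(* A field indexed by the tree is a function on all lists of naturals that is 0 off the tree,
   so that distinct functions are distinct fields. *)
definition fields :: "nat \<Rightarrow> (nat list \<Rightarrow> real) set" where
  "fields b = {h. (\<forall>v. v \<notin> tree b \<longrightarrow> h v = 0) \<and> h [] = 0 \<and> field_norm b h < \<infinity>}"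

definition boundary_measure :: "nat \<Rightarrow> (nat \<Rightarrow> nat) measure" where
  "boundary_measure b = (\<Pi>\<^sub>M i\<in>{1..}. uniform_count_measure {1..b})"

definition ray_prefix :: "(nat \<Rightarrow> nat) \<Rightarrow> nat \<Rightarrow> nat list" where
  "ray_prefix \<xi> k = map \<xi> [1..<Suc k]"

(* For h in fields b the series converges absolutely almost everywhere; on the remaining null
   set suminf takes an irrelevant value. *)
definition H_sum :: "(nat list \<Rightarrow> real) \<Rightarrow> (nat \<Rightarrow> nat) \<Rightarrow> real" where
  "H_sum h \<xi> = (\<Sum>k. h (ray_prefix \<xi> (Suc k)))"

definition Psi :: "nat \<Rightarrow> real set \<Rightarrow> (nat list \<Rightarrow> real) \<Rightarrow> real" where
  "Psi b A h = (LINT \<xi>|boundary_measure b. g_fun A (H_sum h \<xi>))"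

definition power_sum :: "nat \<Rightarrow> real \<Rightarrow> (nat list \<Rightarrow> real) \<Rightarrow> ennreal" where
  "power_sum b \<alpha> h = (\<Sum>\<^sub>\<infinity>v\<in>tree b - {[]}. ennreal (\<bar>h v\<bar> powr \<alpha>))"

definition energy :: "nat \<Rightarrow> real \<Rightarrow> real \<Rightarrow> (nat list \<Rightarrow> real) \<Rightarrow> ennreal" where
  "energy b lam \<alpha> h = ennreal lam * power_sum b \<alpha> h"

(* The real power is extended to ennreal by sending infinity to infinity (alpha > 0). *)
definition lnorm :: "nat \<Rightarrow> real \<Rightarrow> (nat list \<Rightarrow> real) \<Rightarrow> ennreal" where
  "lnorm b \<alpha> h = (if power_sum b \<alpha> h = \<infinity> then \<infinity>
     else ennreal (enn2real (power_sum b \<alpha> h) powr (1 / \<alpha>)))"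

definition Q_fun :: "nat \<Rightarrow> real \<Rightarrow> real \<Rightarrow> real set \<Rightarrow> real \<Rightarrow> ennreal" where
  "Q_fun b lam \<alpha> A q = Inf {energy b lam \<alpha> h | h. h \<in> fields b \<and> Psi b A h = q}"

(* The right limit exists for p in the range where Q_fun is increasing; Lim is unspecified
   elsewhere. *)
definition Q_right :: "nat \<Rightarrow> real \<Rightarrow> real \<Rightarrow> real set \<Rightarrow> real \<Rightarrow> ennreal" where
  "Q_right b lam \<alpha> A p = Lim (at_right p) (Q_fun b lam \<alpha> A)"

definition optimizers :: "nat \<Rightarrow> real \<Rightarrow> real \<Rightarrow> real set \<Rightarrow> real \<Rightarrow> (nat list \<Rightarrow> real) set" where
  "optimizers b lam \<alpha> A p =
     {h \<in> fields b. Psi b A h = p \<and> energy b lam \<alpha> h = Q_fun b lam \<alpha> A p}"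

definition upper_fields :: "nat \<Rightarrow> real \<Rightarrow> real \<Rightarrow> real set \<Rightarrow> real \<Rightarrow> (nat list \<Rightarrow> real) set" where
  "upper_fields b lam \<alpha> A p = {h \<in> fields b. energy b lam \<alpha> h < \<infinity> \<and> Psi b A h > p}"

definition rho :: "nat \<Rightarrow> real \<Rightarrow> real \<Rightarrow> real set \<Rightarrow> real \<Rightarrow> ennreal" where
  "rho b lam \<alpha> A p = Inf {lnorm b \<alpha> (\<lambda>v. h' v - h v) | h h'.
     h \<in> optimizers b lam \<alpha> A p \<and> h' \<in> upper_fields b lam \<alpha> A p}"

end

theory Submission
  imports Defs
begin

text \<open>The point is that sublevel sets of the energy are compact for pointwise convergence and that
  \<open>\<Psi>\<close> is continuous on them. Since \<open>g_A\<close> is Lipschitz, \<open>\<Psi>\<close> is Lipschitz for the norm of the space of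
  fields; the contribution of level \<open>k\<close> to that norm decays geometrically in \<open>k\<close>, uniformly on
  energy sublevel sets, and each level is finite. Hence a sequence of fields with
  \<open>\<Psi>(h\<^sub>n) \<rightarrow> q\<close> and energies tending to \<open>Q(q)\<close> has a subsequence converging pointwise to a field with \<open>\<Psi>(h) = q\<close>;
  by Fatou the limit is an optimizer, so no energy is lost and the convergence holds in
  \<open>\<ell>\<^sup>\<alpha>\<close>. Applied to optimizers for levels decreasing to \<open>p\<close> this gives (iii) from (i), and applied
  to optimizers for \<open>p\<close> it gives (iii) from (ii). Conversely, scaling a field towards \<open>0\<close> shows that every field
  with \<open>\<Psi>(h) > p\<close> has energy at least \<open>Q(p+)\<close>, and the energy is continuous in \<open>\<ell>\<^sup>\<alpha>\<close>.\<close>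

section \<open>The rooted tree and its boundary\<close>

lemma tree_level_altdef: "tree_level b k = {v. set v \<subseteq> {1..b} \<and> length v = k}"
  by (simp add: tree_level_def tree_def)

lemma finite_tree_level [simp]: "finite (tree_level b k)"
  unfolding tree_level_altdef by (rule finite_lists_length_eq) simp

lemma card_tree_level [simp]: "card (tree_level b k) = b ^ k"
  unfolding tree_level_altdef by (subst card_lists_length_eq) auto

lemma tree_level_Suc_subset: "tree_level b (Suc k) \<subseteq> tree b - {[]}"
  by (auto simp: tree_level_def)

lemma length_ray_prefix [simp]: "length (ray_prefix \<xi> k) = k"
  by (simp add: ray_prefix_def)

text \<open>Rays are indexed from 1 and lists from 0, hence the shift \<open>i - 1\<close>. The
  right side is a finite set of coordinate conditions, the form that a product measure can
  evaluate.\<close>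

lemma ray_prefix_eq_iff:
  "length v = k \<Longrightarrow> ray_prefix \<xi> k = v \<longleftrightarrow> (\<forall>i\<in>{1..k}. \<xi> i = v ! (i - 1))"
proof -
  assume v: "length v = k"
  have "ray_prefix \<xi> k = v \<longleftrightarrow> (\<forall>i<k. \<xi> (Suc i) = v ! i)"
    using v by (auto simp: list_eq_iff_nth_eq ray_prefix_def simp del: upt_Suc)
  also have "\<dots> \<longleftrightarrow> (\<forall>i\<in>{1..k}. \<xi> i = v ! (i - 1))"
  proof safe
    fix i assume *: "\<forall>i<k. \<xi> (Suc i) = v ! i" "i \<in> {1..k}"
    then show "\<xi> i = v ! (i - 1)"
      using *(1)[rule_format, of "i - 1"] by auto
  qed auto
  finally show ?thesis .
qed

lemma product_prob_space_uniform:
  fixes b :: nat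
  assumes "b \<ge> 1"
  shows "product_prob_space (\<lambda>_::nat. uniform_count_measure {1..b})"
proof -
  interpret prob_space "uniform_count_measure {1..b}"
    by (rule prob_space_uniform_count_measure) (use assms in auto)
  show ?thesis by unfold_locales
qed

lemma prob_space_boundary_measure: "b \<ge> 1 \<Longrightarrow> prob_space (boundary_measure b)"
  unfolding boundary_measure_def
  by (intro prob_space_PiM prob_space_uniform_count_measure) auto

lemma ray_prefix_in_tree_level:
  assumes "\<xi> \<in> space (boundary_measure b)"
  shows "ray_prefix \<xi> k \<in> tree_level b k"
  using assms
  by (auto simp: tree_level_altdef boundary_measure_def space_PiM PiE_iff
      space_uniform_count_measure ray_prefix_def simp del: upt_Suc)

section \<open>Cylinders and the integration of functions of a prefix\<close>

definition cylinder :: "nat \<Rightarrow> nat list \<Rightarrow> (nat \<Rightarrow> nat) set" where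
  "cylinder b v = {\<xi> \<in> space (boundary_measure b). ray_prefix \<xi> (length v) = v}"

text \<open>Passing through \<open>v\<close> fixes \<open>k\<close> independent uniform coordinates,
  each at the cost of a factor 1/b.\<close>

lemma
  assumes "b \<ge> 1" "v \<in> tree_level b k"
  shows sets_cylinder: "cylinder b v \<in> sets (boundary_measure b)"
    and emeasure_cylinder: "emeasure (boundary_measure b) (cylinder b v) = ennreal (1 / real b ^ k)"
proof -
  interpret product_prob_space "\<lambda>_::nat. uniform_count_measure {1..b}" "{1..}"
    by (rule product_prob_space_uniform) fact
  have len: "length v = k" and sub: "set v \<subseteq> {1..b}"
    using assms(2) by (auto simp: tree_level_altdef)
  have eq: "cylinder b v = {\<xi> \<in> space (boundary_measure b). \<forall>i\<in>{1..k}. \<xi> i \<in> {v ! (i - 1)}}"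
    unfolding cylinder_def len using ray_prefix_eq_iff[OF len] by auto
  have mem: "v ! (i - 1) \<in> {1..b}" if "i \<in> {1..k}" for i
    using that len by (intro subsetD[OF sub] nth_mem) auto
  have X: "{v ! (i - 1)} \<in> sets (uniform_count_measure {1..b})" if "i \<in> {1..k}" for i
    using mem[OF that] by (auto simp: sets_uniform_count_measure)
  show "cylinder b v \<in> sets (boundary_measure b)"
    unfolding eq boundary_measure_def using X
    by (intro sets.sets_Collect_finite_All) auto
  have "emeasure (boundary_measure b) (cylinder b v) =
      (\<Prod>i\<in>{1..k}. emeasure (uniform_count_measure {1..b}) {v ! (i - 1)})"
    unfolding eq boundary_measure_def using X by (intro emeasure_PiM_Collect) auto
  also have "\<dots> = (\<Prod>i\<in>{1..k}. ennreal (1 / real b))"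
    using mem by (intro prod.cong) (auto simp: emeasure_uniform_count_measure)
  also have "\<dots> = ennreal (1 / real b ^ k)"
    by (simp add: ennreal_power power_divide)
  finally show "emeasure (boundary_measure b) (cylinder b v) = ennreal (1 / real b ^ k)" .
qed

text \<open>Each ray lies in exactly one cylinder of level \<open>k\<close>. The semiring type lets
  the identity serve for real functions, where it gives measurability, and for
  \<open>ennreal\<close>-valued ones, where it gives the integral.\<close>

lemma ray_prefix_sum_cylinder:
  fixes f :: "nat list \<Rightarrow> 'a::semiring_1"
  assumes "\<xi> \<in> space (boundary_measure b)"
  shows "f (ray_prefix \<xi> k) = (\<Sum>v\<in>tree_level b k. f v * indicator (cylinder b v) \<xi>)"
proof -
  have "(\<Sum>v\<in>tree_level b k. f v * indicator (cylinder b v) \<xi>) =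
      (\<Sum>v\<in>tree_level b k. if v = ray_prefix \<xi> k then f v else 0)"
    using assms by (intro sum.cong) (auto simp: cylinder_def tree_level_def indicator_def)
  also have "\<dots> = f (ray_prefix \<xi> k)"
    using ray_prefix_in_tree_level[OF assms] by (subst sum.delta) auto
  finally show ?thesis by simp
qed

lemma measurable_ray_prefix:
  fixes f :: "nat list \<Rightarrow> real"
  assumes "b \<ge> 1"
  shows "(\<lambda>\<xi>. f (ray_prefix \<xi> k)) \<in> borel_measurable (boundary_measure b)"
proof -
  have "(\<lambda>\<xi>. \<Sum>v\<in>tree_level b k. f v * indicator (cylinder b v) \<xi>)
      \<in> borel_measurable (boundary_measure b)"
    using sets_cylinder[OF assms]
    by (intro borel_measurable_sum borel_measurable_times borel_measurable_const
        borel_measurable_indicator)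
  then show ?thesis
    by (subst measurable_cong[OF ray_prefix_sum_cylinder])
qed

lemma nn_integral_ray_prefix:
  fixes f :: "nat list \<Rightarrow> real"
  assumes "b \<ge> 1" "\<And>v. f v \<ge> 0"
  shows "(\<integral>\<^sup>+\<xi>. ennreal (f (ray_prefix \<xi> k)) \<partial>boundary_measure b) =
    ennreal ((\<Sum>v\<in>tree_level b k. f v) / real b ^ k)"
proof -
  have "(\<integral>\<^sup>+\<xi>. ennreal (f (ray_prefix \<xi> k)) \<partial>boundary_measure b) =
      (\<integral>\<^sup>+\<xi>. (\<Sum>v\<in>tree_level b k. ennreal (f v) * indicator (cylinder b v) \<xi>) \<partial>boundary_measure b)"
    by (intro nn_integral_cong ray_prefix_sum_cylinder[where f = "\<lambda>v. ennreal (f v)"])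
  also have "\<dots> = (\<Sum>v\<in>tree_level b k. ennreal (f v) * emeasure (boundary_measure b) (cylinder b v))"
    using sets_cylinder[OF assms(1)] by (subst nn_integral_sum) (auto intro!: sum.cong nn_integral_cmult_indicator)
  also have "\<dots> = (\<Sum>v\<in>tree_level b k. ennreal (f v * (1 / real b ^ k)))"
    using emeasure_cylinder[OF assms(1)] assms(2) by (intro sum.cong) (auto simp flip: ennreal_mult)
  also have "\<dots> = ennreal ((\<Sum>v\<in>tree_level b k. f v) / real b ^ k)"
    using assms by (subst sum_ennreal) (auto simp: sum_divide_distrib)
  finally show ?thesis .
qed

section \<open>Ray sums and the Lipschitz bound for \<open>Psi\<close>\<close>

lemma borel_measurable_H_sum:
  "b \<ge> 1 \<Longrightarrow> H_sum h \<in> borel_measurable (boundary_measure b)"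
  unfolding H_sum_def[abs_def] using measurable_ray_prefix by measurable

text \<open>A vertex of level \<open>k\<close> is hit with probability b^(-k), so the field norm is
  the expected sum of absolute values along a uniformly random ray.\<close>

lemma nn_integral_ray_sum:
  assumes "b \<ge> 1"
  shows "(\<integral>\<^sup>+\<xi>. (\<Sum>k. ennreal \<bar>h (ray_prefix \<xi> (Suc k))\<bar>) \<partial>boundary_measure b) = field_norm b h"
  using measurable_ray_prefix[OF assms, of h]
  by (subst nn_integral_suminf)
    (auto simp: field_norm_def nn_integral_ray_prefix[OF assms, where f = "\<lambda>v. \<bar>h v\<bar>"])

lemma AE_summable_ray:
  assumes "b \<ge> 1" "field_norm b h < \<infinity>"
  shows "AE \<xi> in boundary_measure b. summable (\<lambda>k. h (ray_prefix \<xi> (Suc k)))"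
proof -
  have "AE \<xi> in boundary_measure b. (\<Sum>k. ennreal \<bar>h (ray_prefix \<xi> (Suc k))\<bar>) \<noteq> \<infinity>"
    using measurable_ray_prefix[OF assms(1), of h] assms
    by (intro nn_integral_PInf_AE) (auto simp: nn_integral_ray_sum)
  then show ?thesis
  proof eventually_elim
    case (elim \<xi>)
    then have "summable (\<lambda>k. \<bar>h (ray_prefix \<xi> (Suc k))\<bar>)"
      by (intro summable_suminf_not_top) auto
    then show ?case by (rule summable_rabs_cancel)
  qed
qed

text \<open>On almost every ray both series converge, so the difference of the sums is the sum of
  the differences and the triangle inequality applies. Where the series of absolute differences
  diverges the bound is trivial.\<close>

lemma nn_integral_H_sum_diff_le:
  assumes "b \<ge> 1" "field_norm b h < \<infinity>" "field_norm b h' < \<infinity>"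
  shows "(\<integral>\<^sup>+\<xi>. ennreal \<bar>H_sum h \<xi> - H_sum h' \<xi>\<bar> \<partial>boundary_measure b) \<le> field_norm b (\<lambda>v. h v - h' v)"
  unfolding nn_integral_ray_sum[OF assms(1), symmetric]
proof (rule nn_integral_mono_AE)
  show "AE \<xi> in boundary_measure b. ennreal \<bar>H_sum h \<xi> - H_sum h' \<xi>\<bar>
      \<le> (\<Sum>k. ennreal \<bar>h (ray_prefix \<xi> (Suc k)) - h' (ray_prefix \<xi> (Suc k))\<bar>)"
    using AE_summable_ray[OF assms(1,2)] AE_summable_ray[OF assms(1,3)]
  proof eventually_elim
    case (elim \<xi>)
    define d where "d = (\<lambda>k. h (ray_prefix \<xi> (Suc k)) - h' (ray_prefix \<xi> (Suc k)))"
    have d: "H_sum h \<xi> - H_sum h' \<xi> = suminf d"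
      unfolding H_sum_def d_def using elim by (rule suminf_diff)
    show ?case
    proof (cases "(\<Sum>k. ennreal \<bar>d k\<bar>) = \<infinity>")
      case True
      then show ?thesis by (simp add: d_def)
    next
      case False
      then have s: "summable (\<lambda>k. \<bar>d k\<bar>)"
        by (intro summable_suminf_not_top) auto
      have "ennreal \<bar>suminf d\<bar> \<le> ennreal (\<Sum>k. \<bar>d k\<bar>)"
        by (intro ennreal_leI summable_rabs s)
      also have "\<dots> = (\<Sum>k. ennreal \<bar>d k\<bar>)"
        using s by (intro suminf_ennreal2[symmetric]) auto
      finally show ?thesis by (simp add: d) (simp add: d_def)
    qed
  qed
qed

text \<open>The pointwise Lipschitz bound for \<open>g_fun A\<close> is integrated over the rays,
  and the field norm dominates the L1 distance of the ray sums.\<close>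

lemma Psi_diff_le:
  assumes b: "b \<ge> 1" and L: "L-lipschitz_on UNIV (g_fun A)"
    and h: "field_norm b h < \<infinity>" "field_norm b h' < \<infinity>"
  shows "ennreal \<bar>Psi b A h - Psi b A h'\<bar> \<le> ennreal L * field_norm b (\<lambda>v. h v - h' v)"
proof -
  interpret prob_space "boundary_measure b" by (rule prob_space_boundary_measure) fact
  interpret N: prob_space std_normal_distribution
    by (rule prob_space_normal_density) simp
  have [measurable]: "H_sum f \<in> borel_measurable (boundary_measure b)" for f
    using b by (rule borel_measurable_H_sum)
  have [measurable]: "g_fun A \<in> borel_measurable borel"
    using lipschitz_on_continuous_on[OF L] by (intro borel_measurable_continuous_onI)
  have int: "integrable (boundary_measure b) (\<lambda>\<xi>. g_fun A (H_sum f \<xi>))" for f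
  proof (rule integrable_const_bound[where B = 1])
    show "AE \<xi> in boundary_measure b. norm (g_fun A (H_sum f \<xi>)) \<le> 1"
      by (simp add: g_fun_def gauss_prob_def)
  qed simp
  have "ennreal \<bar>Psi b A h - Psi b A h'\<bar> =
      ennreal \<bar>LINT \<xi>|boundary_measure b. g_fun A (H_sum h \<xi>) - g_fun A (H_sum h' \<xi>)\<bar>"
    unfolding Psi_def by (subst Bochner_Integration.integral_diff) (auto intro: int)
  also have "\<dots> \<le> (\<integral>\<^sup>+\<xi>. ennreal \<bar>g_fun A (H_sum h \<xi>) - g_fun A (H_sum h' \<xi>)\<bar> \<partial>boundary_measure b)"
    using integral_norm_bound_ennreal[of "boundary_measure b"
        "\<lambda>\<xi>. g_fun A (H_sum h \<xi>) - g_fun A (H_sum h' \<xi>)"] int by auto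
  also have "\<dots> \<le> (\<integral>\<^sup>+\<xi>. ennreal L * ennreal \<bar>H_sum h \<xi> - H_sum h' \<xi>\<bar> \<partial>boundary_measure b)"
    using lipschitz_onD[OF L] lipschitz_on_nonneg[OF L]
    by (intro nn_integral_mono) (auto simp: dist_real_def ennreal_leI simp flip: ennreal_mult)
  also have "\<dots> = ennreal L * (\<integral>\<^sup>+\<xi>. ennreal \<bar>H_sum h \<xi> - H_sum h' \<xi>\<bar> \<partial>boundary_measure b)"
    by (rule nn_integral_cmult) simp
  also have "\<dots> \<le> ennreal L * field_norm b (\<lambda>v. h v - h' v)"
    using nn_integral_H_sum_diff_le[OF b h] by (rule mult_left_mono) simp
  finally show ?thesis .
qed

section \<open>Power sums\<close>

text \<open>Below every positive extended real there is a positive real, so real bounds suffice. In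
  this form limits of power sums and of quasi-norms can be compared.\<close>

lemma ennreal_tendsto_0_iff:
  fixes f :: "'a \<Rightarrow> ennreal"
  shows "(f \<longlongrightarrow> 0) F \<longleftrightarrow> (\<forall>e>0. \<forall>\<^sub>F x in F. f x < ennreal e)"
proof safe
  fix e :: real assume "(f \<longlongrightarrow> 0) F" "e > 0"
  then show "\<forall>\<^sub>F x in F. f x < ennreal e" by (intro order_tendstoD(2)) auto
next
  assume *: "\<forall>e>0. \<forall>\<^sub>F x in F. f x < ennreal e"
  show "(f \<longlongrightarrow> 0) F"
  proof (rule order_tendstoI)
    fix e :: ennreal assume "0 < e"
    then obtain e' where e': "0 < ennreal e'" "ennreal e' < e"
      using ennreal_rat_dense[of 0 e] by (metis dense ennreal_cases less_top_ennreal order_less_trans)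
    then have "e' > 0" by simp
    with * have "\<forall>\<^sub>F x in F. f x < ennreal e'" by blast
    then show "\<forall>\<^sub>F x in F. f x < e"
      by (rule eventually_mono) (use e'(2) in order)
  qed simp
qed

text \<open>Along an enumeration of \<open>A\<close> both sides are the same series of nonnegative
  terms. This makes Fatou's lemma and the linearity of the integral available for power
  sums.\<close>

lemma nn_integral_count_space_eq_infsum:
  fixes f :: "'a \<Rightarrow> ennreal"
  assumes "countable A"
  shows "(\<integral>\<^sup>+x. f x \<partial>count_space A) = infsum f A"
proof (cases "finite A")
  case True
  then show ?thesis by (simp add: nn_integral_count_space_finite)
next
  case False
  then have bij: "bij_betw (from_nat_into A) UNIV A"
    using assms by (simp add: bij_betw_from_nat_into)
  have "(\<integral>\<^sup>+x. f x \<partial>count_space A) = (\<Sum>i. f (from_nat_into A i))"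
    by (simp add: nn_integral_count_space_nat flip: nn_integral_bij_count_space[OF bij])
  also have "\<dots> = infsum (\<lambda>i. f (from_nat_into A i)) UNIV"
    by (intro sums_unique[symmetric] has_sum_imp_sums has_sum_infsum nonneg_summable_on_complete) simp
  also have "\<dots> = infsum f A"
    by (rule infsum_reindex_bij_betw[OF bij])
  finally show ?thesis .
qed

lemma power_sum_altdef:
  "power_sum b \<alpha> h = (\<integral>\<^sup>+v. ennreal (\<bar>h v\<bar> powr \<alpha>) \<partial>count_space (tree b - {[]}))"
  unfolding power_sum_def by (rule nn_integral_count_space_eq_infsum[symmetric]) simp

lemma sum_le_power_sum:
  assumes "finite F" "F \<subseteq> tree b - {[]}"
  shows "ennreal (\<Sum>v\<in>F. \<bar>h v\<bar> powr \<alpha>) \<le> power_sum b \<alpha> h"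
proof -
  have "(\<Sum>v\<in>F. ennreal (\<bar>h v\<bar> powr \<alpha>)) \<le> power_sum b \<alpha> h"
    unfolding power_sum_def using assms
    by (subst nonneg_infsum_complete) (auto intro!: SUP_upper)
  then show ?thesis by simp
qed

lemma abs_powr_le_power_sum:
  "v \<in> tree b - {[]} \<Longrightarrow> ennreal (\<bar>h v\<bar> powr \<alpha>) \<le> power_sum b \<alpha> h"
  using sum_le_power_sum[of "{v}" b h \<alpha>] by simp

text \<open>A single term is at most the whole sum. The bound confines all coordinates to one
  compact interval and controls small exponents.\<close>

lemma abs_le_power_sum_root:
  assumes "\<alpha> > 0" "power_sum b \<alpha> h \<le> ennreal S" "S \<ge> 0" "v \<in> tree b - {[]}"
  shows "\<bar>h v\<bar> \<le> S powr (1 / \<alpha>)"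
proof -
  have "\<bar>h v\<bar> powr \<alpha> \<le> S"
    using order_trans[OF abs_powr_le_power_sum[OF assms(4), of h \<alpha>] assms(2)] assms(3) by simp
  then have "(\<bar>h v\<bar> powr \<alpha>) powr (1 / \<alpha>) \<le> S powr (1 / \<alpha>)"
    using assms(1) by (intro powr_mono2) auto
  then show ?thesis using assms(1) by (simp add: powr_powr)
qed

text \<open>Holds for all \<open>\<alpha> > 0\<close>: it replaces both Minkowski's inequality (\<open>\<alpha> \<ge> 1\<close>) and subadditivity
  (\<open>\<alpha> \<le> 1\<close>). The choice \<open>\<delta> = 1\<close> is the quasi-triangle inequality, \<open>\<delta> \<rightarrow> 0\<close> gives continuity.\<close>

lemma powr_add_le:
  fixes x y \<delta> \<alpha> :: real
  assumes "\<alpha> > 0" "\<delta> > 0"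
  shows "\<bar>x + y\<bar> powr \<alpha> \<le> (1 + \<delta>) powr \<alpha> * \<bar>x\<bar> powr \<alpha> + (1 + 1 / \<delta>) powr \<alpha> * \<bar>y\<bar> powr \<alpha>"
proof (cases "\<bar>y\<bar> \<le> \<delta> * \<bar>x\<bar>")
  case True
  then have "\<bar>x + y\<bar> \<le> (1 + \<delta>) * \<bar>x\<bar>" by (simp add: algebra_simps)
  then have "\<bar>x + y\<bar> powr \<alpha> \<le> ((1 + \<delta>) * \<bar>x\<bar>) powr \<alpha>"
    using assms by (intro powr_mono2) auto
  then show ?thesis using assms by (simp add: powr_mult add_increasing2)
next
  case False
  then have "\<bar>x\<bar> \<le> (1 / \<delta>) * \<bar>y\<bar>" using assms by (simp add: field_simps)
  then have "\<bar>x + y\<bar> \<le> (1 + 1 / \<delta>) * \<bar>y\<bar>" by (simp add: algebra_simps)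
  then have "\<bar>x + y\<bar> powr \<alpha> \<le> ((1 + 1 / \<delta>) * \<bar>y\<bar>) powr \<alpha>"
    using assms by (intro powr_mono2) auto
  then have "\<bar>x + y\<bar> powr \<alpha> \<le> (1 + 1 / \<delta>) powr \<alpha> * \<bar>y\<bar> powr \<alpha>"
    using assms by (simp only: powr_mult)
  then show ?thesis by (simp add: add_increasing)
qed

lemma power_sum_add_le:
  assumes "\<alpha> > 0" "\<delta> > 0"
  shows "power_sum b \<alpha> (\<lambda>v. f v + g v) \<le>
    ennreal ((1 + \<delta>) powr \<alpha>) * power_sum b \<alpha> f + ennreal ((1 + 1 / \<delta>) powr \<alpha>) * power_sum b \<alpha> g"
proof -
  have "power_sum b \<alpha> (\<lambda>v. f v + g v) \<le> (\<integral>\<^sup>+v. ennreal ((1 + \<delta>) powr \<alpha>) * ennreal (\<bar>f v\<bar> powr \<alpha>) +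
      ennreal ((1 + 1 / \<delta>) powr \<alpha>) * ennreal (\<bar>g v\<bar> powr \<alpha>) \<partial>count_space (tree b - {[]}))"
    unfolding power_sum_altdef
    using powr_add_le[OF assms] by (intro nn_integral_mono) (simp flip: ennreal_mult' ennreal_plus add: ennreal_leI)
  also have "\<dots> = ennreal ((1 + \<delta>) powr \<alpha>) * power_sum b \<alpha> f +
      ennreal ((1 + 1 / \<delta>) powr \<alpha>) * power_sum b \<alpha> g"
    unfolding power_sum_altdef by (simp add: nn_integral_add nn_integral_cmult)
  finally show ?thesis .
qed

lemma power_sum_diff_le:
  assumes "\<alpha> > 0"
  shows "power_sum b \<alpha> (\<lambda>v. f v - g v) \<le> ennreal (2 powr \<alpha>) * (power_sum b \<alpha> f + power_sum b \<alpha> g)"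
proof -
  have "power_sum b \<alpha> (\<lambda>v. - g v) = power_sum b \<alpha> g"
    by (simp add: power_sum_def)
  then show ?thesis
    using power_sum_add_le[OF assms, of 1 b f "\<lambda>v. - g v"] by (simp add: distrib_left)
qed

lemma power_sum_scale:
  "power_sum b \<alpha> (\<lambda>v. t * f v) = ennreal (\<bar>t\<bar> powr \<alpha>) * power_sum b \<alpha> f"
  unfolding power_sum_altdef
  by (simp add: abs_mult powr_mult ennreal_mult' nn_integral_cmult)

text \<open>Fatou's lemma for counting measure: a pointwise limit may lose mass but cannot gain
  any.\<close>

lemma power_sum_lower_semicontinuous:
  assumes "\<alpha> > 0" "\<And>v. v \<in> tree b - {[]} \<Longrightarrow> (\<lambda>n. hs n v) \<longlonglongrightarrow> h v"
    and "(\<lambda>n. power_sum b \<alpha> (hs n)) \<longlonglongrightarrow> S"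
  shows "power_sum b \<alpha> h \<le> S"
proof -
  have "power_sum b \<alpha> h = (\<integral>\<^sup>+v. liminf (\<lambda>n. ennreal (\<bar>hs n v\<bar> powr \<alpha>)) \<partial>count_space (tree b - {[]}))"
    unfolding power_sum_altdef
  proof (rule nn_integral_cong)
    fix v assume "v \<in> space (count_space (tree b - {[]}))"
    \<comment> \<open>The limit \<open>h v\<close> may be 0; continuity of the power there rests on
      \<open>\<alpha>\<close> being positive.\<close>
    then have "(\<lambda>n. ennreal (\<bar>hs n v\<bar> powr \<alpha>)) \<longlonglongrightarrow> ennreal (\<bar>h v\<bar> powr \<alpha>)"
      using assms(1) by (intro tendsto_ennrealI tendsto_powr' tendsto_rabs assms(2)) auto
    then show "ennreal (\<bar>h v\<bar> powr \<alpha>) = liminf (\<lambda>n. ennreal (\<bar>hs n v\<bar> powr \<alpha>))"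
      by (intro lim_imp_Liminf[symmetric]) simp_all
  qed
  also have "\<dots> \<le> liminf (\<lambda>n. power_sum b \<alpha> (hs n))"
    unfolding power_sum_altdef by (rule nn_integral_liminf) simp
  also have "\<dots> = S" using assms(3) by (simp add: lim_imp_Liminf)
  finally show ?thesis .
qed

text \<open>Fatou's lemma applied to \<open>K (|h\<^sub>n|\<^sup>\<alpha> + |h|\<^sup>\<alpha>) - |h\<^sub>n - h|\<^sup>\<alpha> \<ge> 0\<close>.\<close>

lemma power_sum_diff_tendsto_0:
  assumes "\<alpha> > 0" and lim: "\<And>v. v \<in> tree b - {[]} \<Longrightarrow> (\<lambda>n. hs n v) \<longlonglongrightarrow> h v"
    and S: "(\<lambda>n. power_sum b \<alpha> (hs n)) \<longlonglongrightarrow> power_sum b \<alpha> h" "power_sum b \<alpha> h < \<infinity>"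
  shows "(\<lambda>n. power_sum b \<alpha> (\<lambda>v. hs n v - h v)) \<longlonglongrightarrow> 0"
proof -
  define K where "K = (2::real) powr \<alpha>"
  define T where "T = ennreal K * (power_sum b \<alpha> h + power_sum b \<alpha> h)"
  have K: "K > 0" by (simp add: K_def)
  have T: "T < \<infinity>" using S(2) by (simp add: T_def ennreal_mult_less_top)
  define G where "G = (\<lambda>n v. K * (\<bar>hs n v\<bar> powr \<alpha> + \<bar>h v\<bar> powr \<alpha>) - \<bar>hs n v - h v\<bar> powr \<alpha>)"
  define I where "I = (\<lambda>n. \<integral>\<^sup>+v. ennreal (G n v) \<partial>count_space (tree b - {[]}))"
  have G: "G n v \<ge> 0" for n v
    using powr_add_le[OF assms(1), of 1 "hs n v" "- h v"] by (simp add: G_def K_def distrib_left)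
  \<comment> \<open>The relation is stated as a sum because subtraction in \<open>ennreal\<close> is
    truncated.\<close>
  have I_eq: "I n + power_sum b \<alpha> (\<lambda>v. hs n v - h v) = ennreal K * (power_sum b \<alpha> (hs n) + power_sum b \<alpha> h)" for n
  proof -
    have "I n + power_sum b \<alpha> (\<lambda>v. hs n v - h v) =
        (\<integral>\<^sup>+v. ennreal (G n v) + ennreal (\<bar>hs n v - h v\<bar> powr \<alpha>) \<partial>count_space (tree b - {[]}))"
      by (simp add: I_def power_sum_altdef nn_integral_add)
    also have "\<dots> = (\<integral>\<^sup>+v. ennreal K * (ennreal (\<bar>hs n v\<bar> powr \<alpha>) + ennreal (\<bar>h v\<bar> powr \<alpha>)) \<partial>count_space (tree b - {[]}))"
      using K G by (intro nn_integral_cong) (simp flip: ennreal_plus ennreal_mult, simp add: G_def)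
    also have "\<dots> = ennreal K * (power_sum b \<alpha> (hs n) + power_sum b \<alpha> h)"
      by (simp add: power_sum_altdef nn_integral_add nn_integral_cmult)
    finally show ?thesis .
  qed
  have "T = (\<integral>\<^sup>+v. ennreal (K * (\<bar>h v\<bar> powr \<alpha> + \<bar>h v\<bar> powr \<alpha>)) \<partial>count_space (tree b - {[]}))"
    using K by (simp add: T_def power_sum_altdef nn_integral_cmult ennreal_mult flip: mult_2)
  \<comment> \<open>The subtracted power in \<open>G n v\<close> tends to 0 pointwise, so only the
    positive part survives in the limit.\<close>
  also have "\<dots> = (\<integral>\<^sup>+v. liminf (\<lambda>n. ennreal (G n v)) \<partial>count_space (tree b - {[]}))"
  proof (rule nn_integral_cong)
    fix v assume "v \<in> space (count_space (tree b - {[]}))"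
    then have l: "(\<lambda>n. hs n v) \<longlonglongrightarrow> h v" by (intro lim) auto
    have "(\<lambda>n. ennreal (G n v)) \<longlonglongrightarrow>
        ennreal (K * (\<bar>h v\<bar> powr \<alpha> + \<bar>h v\<bar> powr \<alpha>) - \<bar>h v - h v\<bar> powr \<alpha>)"
      unfolding G_def using assms(1)
      by (intro tendsto_ennrealI tendsto_intros tendsto_powr' l) auto
    then have "(\<lambda>n. ennreal (G n v)) \<longlonglongrightarrow> ennreal (K * (\<bar>h v\<bar> powr \<alpha> + \<bar>h v\<bar> powr \<alpha>))"
      using assms(1) by simp
    then show "ennreal (K * (\<bar>h v\<bar> powr \<alpha> + \<bar>h v\<bar> powr \<alpha>)) = liminf (\<lambda>n. ennreal (G n v))"
      by (intro lim_imp_Liminf[symmetric]) simp_all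
  qed
  also have "\<dots> \<le> liminf I"
    unfolding I_def by (rule nn_integral_liminf) simp
  finally have TI: "T \<le> liminf I" .
  have lim_T: "(\<lambda>n. ennreal K * (power_sum b \<alpha> (hs n) + power_sum b \<alpha> h)) \<longlonglongrightarrow> T"
    unfolding T_def using K by (intro ennreal_tendsto_cmult tendsto_add S tendsto_const) auto
  show ?thesis
    unfolding ennreal_tendsto_0_iff
  proof safe
    fix e :: real assume "0 < e"
    define e' where "e' = e / 2"
    have e': "e' > 0" "e' + e' = e" using \<open>0 < e\<close> by (auto simp: e'_def)
    obtain t where t: "T = ennreal t" "t \<ge> 0" using T by (cases T) auto
    have up: "\<forall>\<^sub>F n in sequentially. ennreal K * (power_sum b \<alpha> (hs n) + power_sum b \<alpha> h) < ennreal (t + e')"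
      using t e' by (intro order_tendstoD(2)[OF lim_T]) (simp add: ennreal_less_iff)
    have lo: "\<forall>\<^sub>F n in sequentially. ennreal t \<le> I n + ennreal e'"
    \<comment> \<open>The lower bound \<open>t - e'\<close> is meaningful as an
      \<open>ennreal\<close> only when it is not negative; otherwise \<open>e'\<close> alone
      dominates \<open>t\<close>.\<close>
    proof (cases "t \<le> e'")
      case True
      then show ?thesis by (intro always_eventually allI add_increasing ennreal_leI) auto
    next
      case False
      then have "ennreal (t - e') < T" using e' t by (simp add: ennreal_less_iff)
      then have "\<forall>\<^sub>F n in sequentially. ennreal (t - e') < I n"
        using TI unfolding le_Liminf_iff by blast
      then show ?thesis
      proof eventually_elim
        case (elim n)
        have "ennreal t = ennreal (t - e') + ennreal e'"
          using False e' by (simp flip: ennreal_plus)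
        also have "\<dots> \<le> I n + ennreal e'" using elim by (intro add_right_mono) auto
        finally show ?case .
      qed
    qed
    show "\<forall>\<^sub>F n in sequentially. power_sum b \<alpha> (\<lambda>v. hs n v - h v) < ennreal e"
      using up lo
    proof eventually_elim
      case (elim n)
      let ?D = "power_sum b \<alpha> (\<lambda>v. hs n v - h v)"
      have less: "I n + ?D < ennreal (t + e')" using elim(1) by (simp add: I_eq)
      \<comment> \<open>Both bounds on the limit \<open>T\<close> combine to
        \<open>I n + ?D < I n + e\<close>, and the finite \<open>I n\<close> can be
        cancelled.\<close>
      then have fin: "I n \<noteq> \<infinity>" by auto
      note less
      also have "ennreal (t + e') = ennreal t + ennreal e'" using t e' by simp
      also have "\<dots> \<le> I n + ennreal e' + ennreal e'" using elim(2) by (intro add_right_mono)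
      also have "\<dots> = I n + ennreal e" using e' by (simp add: add.assoc flip: ennreal_plus)
      finally show ?case using fin by (simp add: ennreal_add_left_cancel_less)
    qed
  qed
qed

section \<open>From power sums to the quasi-norm\<close>

lemma lnorm_eq:
  assumes "\<alpha> > 0" "x \<ge> 0" "power_sum b \<alpha> h = ennreal x"
  shows "lnorm b \<alpha> h = ennreal (x powr (1 / \<alpha>))"
  using assms by (simp add: lnorm_def)

lemma lnorm_less_iff:
  assumes "\<alpha> > 0" "e > 0"
  shows "lnorm b \<alpha> h < ennreal e \<longleftrightarrow> power_sum b \<alpha> h < ennreal (e powr \<alpha>)"
proof (cases "power_sum b \<alpha> h")
  case (real x)
  have "x powr (1 / \<alpha>) < e \<longleftrightarrow> x < e powr \<alpha>"
  proof
    assume "x powr (1 / \<alpha>) < e"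
    then have "(x powr (1 / \<alpha>)) powr \<alpha> < e powr \<alpha>" using assms by (intro powr_less_mono2) auto
    then show "x < e powr \<alpha>" using assms real by (simp add: powr_powr)
  next
    assume "x < e powr \<alpha>"
    then have "x powr (1 / \<alpha>) < (e powr \<alpha>) powr (1 / \<alpha>)" using assms real by (intro powr_less_mono2) auto
    then show "x powr (1 / \<alpha>) < e" using assms by (simp add: powr_powr)
  qed
  then show ?thesis using assms real by (simp add: lnorm_eq ennreal_less_iff)
next
  case top
  then show ?thesis by (simp add: lnorm_def)
qed

text \<open>As \<open>e\<close> runs through the positive reals so does
  \<open>e powr \<alpha>\<close>. All later limits can therefore be taken for power sums, which need
  no distinction between norm and quasi-norm.\<close>

lemma lnorm_tendsto_0_iff:
  assumes "\<alpha> > 0"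
  shows "((\<lambda>n. lnorm b \<alpha> (hs n)) \<longlongrightarrow> 0) F \<longleftrightarrow> ((\<lambda>n. power_sum b \<alpha> (hs n)) \<longlongrightarrow> 0) F"
proof -
  have "(\<forall>e>0. \<forall>\<^sub>F n in F. power_sum b \<alpha> (hs n) < ennreal (e powr \<alpha>)) \<longleftrightarrow>
      (\<forall>e>0. \<forall>\<^sub>F n in F. power_sum b \<alpha> (hs n) < ennreal e)"
  proof safe
    fix e :: real assume *: "\<forall>e>0. \<forall>\<^sub>F n in F. power_sum b \<alpha> (hs n) < ennreal (e powr \<alpha>)" "e > 0"
    then show "\<forall>\<^sub>F n in F. power_sum b \<alpha> (hs n) < ennreal e"
      using *(1)[rule_format, of "e powr (1 / \<alpha>)"] assms by (simp add: powr_powr)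
  qed simp
  then show ?thesis
    using lnorm_less_iff[OF assms] by (simp add: ennreal_tendsto_0_iff)
qed

section \<open>Compactness of energy sublevel sets\<close>

text \<open>Tychonoff's theorem makes the cube compact; over a countable index type the product
  topology is first countable, so the cube is also sequentially compact.\<close>

lemma pointwise_convergent_subsequence:
  fixes f :: "nat \<Rightarrow> 'a::countable \<Rightarrow> real"
  assumes "\<And>n v. \<bar>f n v\<bar> \<le> M"
  obtains r l where "strict_mono (r :: nat \<Rightarrow> nat)" "\<And>v. (\<lambda>n. f (r n) v) \<longlonglongrightarrow> l v"
proof -
  have "compactin (product_topology (\<lambda>_::'a. euclidean) UNIV) (\<Pi>\<^sub>E v\<in>UNIV. {-M..M})"
    unfolding compactin_PiE by simp
  then have "compact (\<Pi>\<^sub>E v\<in>(UNIV::'a set). {-M..M})"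
    by (simp add: euclidean_product_topology)
  then have "seq_compact (\<Pi>\<^sub>E v\<in>(UNIV::'a set). {-M..M})"
    by (rule compact_imp_seq_compact)
  moreover have "f n \<in> (\<Pi>\<^sub>E v\<in>(UNIV::'a set). {-M..M})" for n
    using assms by (auto simp: PiE_UNIV_domain abs_le_iff minus_le_iff)
  ultimately obtain l r where r: "strict_mono (r :: nat \<Rightarrow> nat)" "(f \<circ> r) \<longlonglongrightarrow> l"
    unfolding seq_compact_def by metis
  show ?thesis
  proof (rule that)
    fix v
    have "isCont (\<lambda>x :: 'a \<Rightarrow> real. x v) l"
      using continuous_on_product_coordinates[of v] continuous_on_eq_continuous_at open_UNIV by blast
    then show "(\<lambda>n. f (r n) v) \<longlonglongrightarrow> l v"
      using isCont_tendsto_compose[OF _ r(2)] by simp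
  qed (rule r)
qed

text \<open>The set \<open>A\<close> enters through a Lipschitz constant of \<open>g_fun A\<close>;
  for a finite union of intervals the number of intervals will serve as \<open>L\<close>.\<close>

locale lipschitz_tree =
  fixes b :: nat and lam \<alpha> L :: real and A :: "real set"
  assumes b: "b \<ge> 2" and lam: "lam > 0" and \<alpha>: "\<alpha> > 0"
    and lip: "L-lipschitz_on UNIV (g_fun A)"
begin

text \<open>For \<open>\<alpha> \<ge> 1\<close> use \<open>|x| \<le> \<epsilon> + |x|\<^sup>\<alpha> \<epsilon> powr (1 - \<alpha>)\<close> with \<open>\<epsilon> = b powr (- k / \<alpha>)\<close>;
  for \<open>\<alpha> < 1\<close> the power sum bounds \<open>\<Sum> |h v|\<close> directly.\<close>

lemma level_mean_le_geometric:
  assumes S: "S \<ge> 0"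
  obtains D c where "D \<ge> 0" "0 < c" "c < 1"
    "\<And>h k. power_sum b \<alpha> h \<le> ennreal S \<Longrightarrow>
      (\<Sum>v\<in>tree_level b (Suc k). \<bar>h v\<bar>) / real b ^ Suc k \<le> D * c ^ Suc k"
proof -
  have level: "(\<Sum>v\<in>tree_level b (Suc k). \<bar>h v\<bar> powr \<alpha>) \<le> S"
    if "power_sum b \<alpha> h \<le> ennreal S" for h k
    using order_trans[OF sum_le_power_sum[OF _ tree_level_Suc_subset] that] S by simp
  show ?thesis
  proof (cases "\<alpha> \<ge> 1")
    case True
    define c where "c = real b powr (- 1 / \<alpha>)"
    show ?thesis
    proof (rule that[of "1 + S" c])
      show "c < 1" using b \<alpha> powr_less_one[of "real b" "- 1 / \<alpha>"] by (simp add: c_def)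
      fix h k assume h: "power_sum b \<alpha> h \<le> ennreal S"
      define n where "n = Suc k"
      define \<epsilon> where "\<epsilon> = c ^ n"
      have \<epsilon>: "\<epsilon> > 0" using b by (simp add: \<epsilon>_def c_def)
      \<comment> \<open>Since \<open>\<epsilon> powr \<alpha>\<close> is b^(-n), the two terms of
        the bound below contribute \<open>\<epsilon>\<close> and at most
        \<open>S * \<epsilon>\<close> to the level mean.\<close>
      have \<epsilon>_powr: "\<epsilon> powr (1 - \<alpha>) = \<epsilon> * real b ^ n"
      proof -
        have "\<epsilon> = real b powr (- real n / \<alpha>)"
          using b by (simp add: \<epsilon>_def c_def powr_power)
        moreover have "- real n / \<alpha> * (1 - \<alpha>) = - real n / \<alpha> + real n"
          using \<alpha> by (simp add: field_simps)
        then have "real b powr (- real n / \<alpha> * (1 - \<alpha>)) =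
            real b powr (- real n / \<alpha>) * real b powr real n"
          by (simp only: powr_add)
        ultimately show ?thesis using b by (simp add: powr_powr powr_realpow)
      qed
      have le: "\<bar>x\<bar> \<le> \<epsilon> + \<bar>x\<bar> powr \<alpha> * \<epsilon> powr (1 - \<alpha>)" for x :: real
      proof (cases "\<bar>x\<bar> \<le> \<epsilon>")
        case True
        then show ?thesis by (intro add_increasing2) auto
      next
        case False
        then have "\<bar>x\<bar> = \<bar>x\<bar> powr \<alpha> * \<bar>x\<bar> powr (1 - \<alpha>)"
          using \<epsilon> by (simp flip: powr_add)
        also have "\<dots> \<le> \<bar>x\<bar> powr \<alpha> * \<epsilon> powr (1 - \<alpha>)"
          using False \<epsilon> \<open>\<alpha> \<ge> 1\<close> by (intro mult_left_mono powr_mono2') auto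
        finally show ?thesis using \<epsilon> by simp
      qed
      have "(\<Sum>v\<in>tree_level b n. \<bar>h v\<bar>) \<le> (\<Sum>v\<in>tree_level b n. \<epsilon> + \<bar>h v\<bar> powr \<alpha> * \<epsilon> powr (1 - \<alpha>))"
        by (intro sum_mono le)
      also have "\<dots> = real b ^ n * \<epsilon> + (\<Sum>v\<in>tree_level b n. \<bar>h v\<bar> powr \<alpha>) * (\<epsilon> * real b ^ n)"
        by (simp add: sum.distrib sum_distrib_right \<epsilon>_powr)
      also have "\<dots> \<le> real b ^ n * \<epsilon> + S * (\<epsilon> * real b ^ n)"
        using level[OF h] \<epsilon> by (intro add_left_mono mult_right_mono) (auto simp: n_def)
      finally show "(\<Sum>v\<in>tree_level b (Suc k). \<bar>h v\<bar>) / real b ^ Suc k \<le> (1 + S) * c ^ Suc k"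
        using b unfolding n_def[symmetric] \<epsilon>_def[symmetric]
        by (simp add: field_simps)
    qed (use S b in \<open>auto simp: c_def\<close>)
  next
    case False
    \<comment> \<open>Every coordinate is at most \<open>S powr (1 / \<alpha>)\<close>, so
      \<open>R\<close> bounds \<open>\<bar>h v\<bar> powr (1 - \<alpha>)\<close>, the factor by
      which \<open>\<bar>h v\<bar>\<close> exceeds its power. Level sums are then at most
      \<open>R * S\<close>, and averaging supplies the ratio 1/b.\<close>
    define R where "R = (S powr (1 / \<alpha>)) powr (1 - \<alpha>)"
    show ?thesis
    proof (rule that[of "R * S" "1 / b"])
      fix h k assume h: "power_sum b \<alpha> h \<le> ennreal S"
      have "\<bar>h v\<bar> \<le> R * \<bar>h v\<bar> powr \<alpha>" if "v \<in> tree_level b (Suc k)" for v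
      proof -
        have "\<bar>h v\<bar> powr (1 - \<alpha>) \<le> R"
          unfolding R_def using False abs_le_power_sum_root[OF \<alpha> h S] that tree_level_Suc_subset
          by (intro powr_mono2) auto
        then have "\<bar>h v\<bar> powr (1 - \<alpha>) * \<bar>h v\<bar> powr \<alpha> \<le> R * \<bar>h v\<bar> powr \<alpha>"
          by (intro mult_right_mono) auto
        then show ?thesis by (simp flip: powr_add)
      qed
      then have "(\<Sum>v\<in>tree_level b (Suc k). \<bar>h v\<bar>) \<le> (\<Sum>v\<in>tree_level b (Suc k). R * \<bar>h v\<bar> powr \<alpha>)"
        by (rule sum_mono)
      also have "\<dots> \<le> R * S"
        unfolding sum_distrib_left[symmetric] using level[OF h] by (intro mult_left_mono) (auto simp: R_def)
      finally show "(\<Sum>v\<in>tree_level b (Suc k). \<bar>h v\<bar>) / real b ^ Suc k \<le> R * S * (1 / b) ^ Suc k"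
        using b by (simp add: power_divide divide_right_mono del: power_Suc)
    qed (use S b in \<open>auto simp: R_def\<close>)
  qed
qed

lemma suminf_geometric_less_top:
  fixes c :: real
  assumes "D \<ge> 0" "0 < c" "c < 1"
  shows "(\<Sum>k. ennreal (D * c ^ Suc k)) < \<infinity>"
proof -
  have "summable (\<lambda>k. D * c ^ Suc k)"
    using assms by (intro summable_mult summable_Suc_iff[THEN iffD2] summable_geometric) auto
  then have "(\<Sum>k. ennreal (D * c ^ Suc k)) = ennreal (\<Sum>k. D * c ^ Suc k)"
    using assms by (intro suminf_ennreal2) auto
  then show ?thesis by simp
qed

text \<open>A finite power sum forces geometrically decaying level means, hence a finite field
  norm.\<close>

lemma fieldsI:
  assumes "\<And>v. v \<notin> tree b - {[]} \<Longrightarrow> h v = 0" "power_sum b \<alpha> h < \<infinity>"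
  shows "h \<in> fields b"
proof -
  obtain S where S: "S \<ge> 0" "power_sum b \<alpha> h = ennreal S"
    using assms(2) by (cases "power_sum b \<alpha> h") auto
  obtain D c where Dc: "D \<ge> 0" "0 < c" "c < 1"
    "\<And>h k. power_sum b \<alpha> h \<le> ennreal S \<Longrightarrow>
      (\<Sum>v\<in>tree_level b (Suc k). \<bar>h v\<bar>) / real b ^ Suc k \<le> D * c ^ Suc k"
    using level_mean_le_geometric[OF S(1)] by blast
  have "field_norm b h \<le> (\<Sum>k. ennreal (D * c ^ Suc k))"
    unfolding field_norm_def using S(2) by (intro suminf_le ennreal_leI Dc(4) summableI) auto
  also have "\<dots> < \<infinity>" by (rule suminf_geometric_less_top) fact+
  finally show ?thesis using assms(1) by (auto simp: fields_def)
qed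

text \<open>Each level is finite, so its contribution to the field norm of \<open>hs n - h\<close>
  vanishes in the limit; the geometric bound on the level means is a majorant independent of
  \<open>n\<close>, and dominated convergence over the levels applies.\<close>

lemma Psi_tendsto:
  assumes C: "C \<ge> 0"
    and fields: "\<And>n. hs n \<in> fields b" "h \<in> fields b"
    and bound: "\<And>n. power_sum b \<alpha> (hs n) \<le> ennreal C" "power_sum b \<alpha> h \<le> ennreal C"
    and lim: "\<And>v. (\<lambda>n. hs n v) \<longlonglongrightarrow> h v"
  shows "(\<lambda>n. Psi b A (hs n)) \<longlonglongrightarrow> Psi b A h"
proof -
  define S where "S = 2 powr \<alpha> * (C + C)"
  have S: "S \<ge> 0" using C by (simp add: S_def)
  have "power_sum b \<alpha> (\<lambda>v. hs n v - h v) \<le> ennreal S" for n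
  proof -
    have "power_sum b \<alpha> (\<lambda>v. hs n v - h v) \<le> ennreal (2 powr \<alpha>) * (ennreal (C) + ennreal (C))"
      using bound by (intro order_trans[OF power_sum_diff_le[OF \<alpha>]] mult_left_mono add_mono) auto
    also have "\<dots> = ennreal S"
      using C by (simp add: S_def ennreal_mult ennreal_plus[symmetric] del: ennreal_plus)
    finally show ?thesis .
  qed
  moreover obtain D c where Dc: "D \<ge> 0" "0 < c" "c < 1"
    "\<And>h k. power_sum b \<alpha> h \<le> ennreal S \<Longrightarrow>
      (\<Sum>v\<in>tree_level b (Suc k). \<bar>h v\<bar>) / real b ^ Suc k \<le> D * c ^ Suc k"
    using level_mean_le_geometric[OF S] by blast
  ultimately have le: "(\<Sum>v\<in>tree_level b (Suc k). \<bar>hs n v - h v\<bar>) / real b ^ Suc k \<le> D * c ^ Suc k" for n k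
    by blast
  have "(\<lambda>n. \<integral>\<^sup>+k. ennreal ((\<Sum>v\<in>tree_level b (Suc k). \<bar>hs n v - h v\<bar>) / real b ^ Suc k) \<partial>count_space UNIV)
      \<longlonglongrightarrow> (\<integral>\<^sup>+(k::nat). 0 \<partial>count_space UNIV)"
  proof (rule nn_integral_dominated_convergence[where w = "\<lambda>k. ennreal (D * c ^ Suc k)"])
    show "(\<integral>\<^sup>+k. ennreal (D * c ^ Suc k) \<partial>count_space UNIV) < \<infinity>"
      using suminf_geometric_less_top[OF Dc(1-3)] by (simp add: nn_integral_count_space_nat)
    show "AE k in count_space UNIV. (\<lambda>n. ennreal ((\<Sum>v\<in>tree_level b (Suc k). \<bar>hs n v - h v\<bar>) / real b ^ Suc k)) \<longlonglongrightarrow> 0"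
    proof (intro AE_I2)
      fix k
      have "(\<lambda>n. ennreal ((\<Sum>v\<in>tree_level b (Suc k). \<bar>hs n v - h v\<bar>) / real b ^ Suc k)) \<longlonglongrightarrow>
          ennreal ((\<Sum>v\<in>tree_level b (Suc k). \<bar>h v - h v\<bar>) / real b ^ Suc k)"
        using b by (intro tendsto_ennrealI tendsto_intros lim) auto
      then show "(\<lambda>n. ennreal ((\<Sum>v\<in>tree_level b (Suc k). \<bar>hs n v - h v\<bar>) / real b ^ Suc k)) \<longlonglongrightarrow> 0"
        by simp
    qed
  qed (auto intro!: ennreal_leI le simp del: power_Suc)
  then have norm: "(\<lambda>n. field_norm b (\<lambda>v. hs n v - h v)) \<longlonglongrightarrow> 0"
    by (simp add: field_norm_def nn_integral_count_space_nat)
  have "(\<lambda>n. ennreal L * field_norm b (\<lambda>v. hs n v - h v)) \<longlonglongrightarrow> ennreal L * 0"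
    by (intro ennreal_tendsto_cmult norm) simp
  moreover have "ennreal \<bar>Psi b A (hs n) - Psi b A h\<bar> \<le> ennreal L * field_norm b (\<lambda>v. hs n v - h v)" for n
    using fields b by (intro Psi_diff_le lip) (auto simp: fields_def)
  ultimately have "(\<lambda>n. ennreal \<bar>Psi b A (hs n) - Psi b A h\<bar>) \<longlonglongrightarrow> 0"
    using tendsto_sandwich[OF _ _ tendsto_const, of 0
        "\<lambda>n. ennreal \<bar>Psi b A (hs n) - Psi b A h\<bar>" sequentially
        "\<lambda>n. ennreal L * field_norm b (\<lambda>v. hs n v - h v)"] by simp
  then have "(\<lambda>n. ennreal \<bar>Psi b A (hs n) - Psi b A h\<bar>) \<longlonglongrightarrow> ennreal 0"
    by simp
  then have "(\<lambda>n. \<bar>Psi b A (hs n) - Psi b A h\<bar>) \<longlonglongrightarrow> 0"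
    by (subst (asm) tendsto_ennreal_iff) auto
  then show ?thesis
    by (simp add: tendsto_rabs_zero_iff LIM_zero_iff)
qed

section \<open>Minimizing sequences and existence of optimizers\<close>

lemma Q_fun_le_energy_self: "h \<in> fields b \<Longrightarrow> Q_fun b lam \<alpha> A (Psi b A h) \<le> energy b lam \<alpha> h"
  unfolding Q_fun_def by (rule Inf_lower) auto

lemma energy_eq_power_sum: "power_sum b \<alpha> h = ennreal (1 / lam) * energy b lam \<alpha> h"
  using lam by (simp add: energy_def mult.assoc[symmetric] flip: ennreal_mult)

lemma energy_less_top_iff: "energy b lam \<alpha> h < \<infinity> \<longleftrightarrow> power_sum b \<alpha> h < \<infinity>"
  using lam by (auto simp: energy_def ennreal_mult_less_top)

text \<open>Only the limits of \<open>Psi\<close> and of the energy are prescribed, so the lemma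
  covers minimizing sequences at level \<open>q\<close>, optimizers at levels tending to
  \<open>q\<close>, and sequences of optimizers at \<open>q\<close> itself.\<close>

lemma minimizing_sequence_compact:
  assumes fields: "\<And>n. hs n \<in> fields b"
    and energy: "(\<lambda>n. energy b lam \<alpha> (hs n)) \<longlonglongrightarrow> Q_fun b lam \<alpha> A q"
    and fin: "Q_fun b lam \<alpha> A q < \<infinity>"
    and Psi: "(\<lambda>n. Psi b A (hs n)) \<longlonglongrightarrow> q"
  obtains r h where "strict_mono (r :: nat \<Rightarrow> nat)" "h \<in> optimizers b lam \<alpha> A q"
    "(\<lambda>n. power_sum b \<alpha> (\<lambda>v. hs (r n) v - h v)) \<longlonglongrightarrow> 0"
proof -
  define s where "s = ennreal (1 / lam) * Q_fun b lam \<alpha> A q"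
  have s: "s < \<infinity>" using fin by (simp add: s_def ennreal_mult_less_top)
  have Q_eq: "Q_fun b lam \<alpha> A q = ennreal lam * s"
    using lam by (simp add: s_def mult.assoc[symmetric] flip: ennreal_mult)
  have lim_s: "(\<lambda>n. power_sum b \<alpha> (hs n)) \<longlonglongrightarrow> s"
    unfolding energy_eq_power_sum s_def by (intro ennreal_tendsto_cmult energy) simp
  obtain C where C: "C \<ge> 0" "s < ennreal C"
    using s by (metis ennreal_Ex_less_of_nat ennreal_of_nat_eq_real_of_nat infinity_ennreal_def of_nat_0_le_iff)
  \<comment> \<open>Dropping the first \<open>N\<close> fields makes the bound \<open>C\<close>
    uniform.\<close>
  obtain N where N: "\<And>n. n \<ge> N \<Longrightarrow> power_sum b \<alpha> (hs n) < ennreal C"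
    using order_tendstoD(2)[OF lim_s C(2)] by (auto simp: eventually_sequentially)
  have bound: "\<bar>hs (n + N) v\<bar> \<le> C powr (1 / \<alpha>)" for n v
  proof (cases "v \<in> tree b - {[]}")
    case True
    with N[of "n + N"] show ?thesis
      by (intro abs_le_power_sum_root[OF \<alpha>, of b]) (auto simp: C)
  qed (use fields in \<open>auto simp: fields_def\<close>)
  obtain r h where r: "strict_mono (r :: nat \<Rightarrow> nat)" and h: "\<And>v. (\<lambda>n. hs (r n + N) v) \<longlonglongrightarrow> h v"
    using pointwise_convergent_subsequence[of "\<lambda>n. hs (n + N)", OF bound] by metis
  define r' where "r' = (\<lambda>n. r n + N)"
  have r': "strict_mono r'" using r by (auto simp: strict_mono_def r'_def)
  have h': "(\<lambda>n. hs (r' n) v) \<longlonglongrightarrow> h v" for v using h by (simp add: r'_def)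
  have sub: "(\<lambda>n. power_sum b \<alpha> (hs (r' n))) \<longlonglongrightarrow> s"
    using LIMSEQ_subseq_LIMSEQ[OF lim_s r'] by (simp add: o_def)
  have le_s: "power_sum b \<alpha> h \<le> s"
    by (rule power_sum_lower_semicontinuous[OF \<alpha> h' sub])
  have zero: "h v = 0" if "v \<notin> tree b - {[]}" for v
    using that fields h'[of v] by (auto simp: fields_def LIMSEQ_const_iff)
  have h_fields: "h \<in> fields b"
    using zero le_s s by (intro fieldsI) auto
  have "(\<lambda>n. Psi b A (hs (r' n))) \<longlonglongrightarrow> Psi b A h"
    using N le_s C by (intro Psi_tendsto[where C = C] C(1) fields h_fields h') (auto simp: r'_def less_imp_le)
  moreover have "(\<lambda>n. Psi b A (hs (r' n))) \<longlonglongrightarrow> q"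
    using LIMSEQ_subseq_LIMSEQ[OF Psi r'] by (simp add: o_def)
  ultimately have Psi_h: "Psi b A h = q" by (rule LIMSEQ_unique)
  \<comment> \<open>The limit competes in the infimum at level \<open>q\<close>, so its energy is at
    least \<open>Q_fun b lam \<alpha> A q\<close>. Together with Fatou's inequality this excludes a
    loss of energy.\<close>
  have "ennreal lam * s \<le> ennreal lam * power_sum b \<alpha> h"
    using Q_fun_le_energy_self[OF h_fields] by (simp add: Psi_h Q_eq energy_def)
  then have "s \<le> power_sum b \<alpha> h"
    using lam by (simp add: ennreal_mult_le_mult_iff)
  with le_s have s_eq: "power_sum b \<alpha> h = s" by simp
  show ?thesis
  proof (rule that[OF r'])
    show "h \<in> optimizers b lam \<alpha> A q"
      using h_fields Psi_h by (simp add: optimizers_def energy_def s_eq Q_eq)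
    show "(\<lambda>n. power_sum b \<alpha> (\<lambda>v. hs (r' n) v - h v)) \<longlonglongrightarrow> 0"
      using sub s by (intro power_sum_diff_tendsto_0[OF \<alpha> h']) (simp_all add: s_eq)
  qed
qed

text \<open>The direct method: finiteness rules out the empty infimum, and fields whose energies
  tend to the infimum, all with \<open>Psi\<close> equal to \<open>q\<close>, have a subsequence
  converging to a minimizer.\<close>

lemma optimizers_nonempty:
  assumes "Q_fun b lam \<alpha> A q < \<infinity>"
  obtains h where "h \<in> optimizers b lam \<alpha> A q"
proof -
  let ?E = "{energy b lam \<alpha> h | h. h \<in> fields b \<and> Psi b A h = q}"
  have "?E \<noteq> {}"
  proof
    assume "?E = {}"
    then have "Q_fun b lam \<alpha> A q = Inf {}"
      unfolding Q_fun_def by (rule arg_cong)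
    with assms show False by simp
  qed
  from Inf_as_limit[OF this] obtain u where u: "\<And>n. u n \<in> ?E" "u \<longlonglongrightarrow> Q_fun b lam \<alpha> A q"
    unfolding Q_fun_def by blast
  from u(1) have "\<forall>n. \<exists>h. h \<in> fields b \<and> Psi b A h = q \<and> u n = energy b lam \<alpha> h" by blast
  then obtain hs where hs: "\<And>n. hs n \<in> fields b" "\<And>n. Psi b A (hs n) = q" "\<And>n. u n = energy b lam \<alpha> (hs n)"
    by metis
  have "u = (\<lambda>n. energy b lam \<alpha> (hs n))" by (rule ext) (rule hs(3))
  with u(2) have "(\<lambda>n. energy b lam \<alpha> (hs n)) \<longlonglongrightarrow> Q_fun b lam \<alpha> A q" by simp
  moreover have "(\<lambda>n. Psi b A (hs n)) \<longlonglongrightarrow> q" by (simp add: hs(2))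
  ultimately show ?thesis
    using minimizing_sequence_compact[of hs q, OF hs(1) _ assms] that by blast
qed

end

section \<open>The cost function and the equivalences\<close>

lemma g_fun_0: "g_fun A 0 = gauss_prob A"
  by (simp add: g_fun_def shift_set_def)

lemma g_fun_le_1: "g_fun A x \<le> 1"
proof -
  interpret prob_space std_normal_distribution
    by (rule prob_space_normal_density) simp
  show ?thesis by (simp add: g_fun_def gauss_prob_def)
qed

lemma obtain_g_fun_greater:
  assumes "q < M_sup A"
  obtains x where "q < g_fun A x"
proof -
  have "bdd_above (range (g_fun A))"
    using g_fun_le_1 by (intro bdd_aboveI[of _ 1]) auto
  then show ?thesis
    using assms that unfolding M_sup_def by (subst (asm) less_cSUP_iff) auto
qed

context lipschitz_tree
begin

lemma Psi_zero: "Psi b A (\<lambda>v. 0) = gauss_prob A"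
proof -
  interpret prob_space "boundary_measure b"
    using b by (intro prob_space_boundary_measure) simp
  show ?thesis by (simp add: Psi_def H_sum_def g_fun_0 prob_space)
qed

text \<open>Scaling a field towards \<open>0\<close> decreases its energy and moves \<open>\<Psi>\<close>
  continuously to \<open>\<nu>(A)\<close>.\<close>

lemma Q_fun_le_energy:
  assumes h: "h \<in> fields b" and q: "gauss_prob A \<le> q" "q \<le> Psi b A h"
  shows "Q_fun b lam \<alpha> A q \<le> energy b lam \<alpha> h"
proof (cases "power_sum b \<alpha> h")
  case (real C)
  have scale_le: "power_sum b \<alpha> (\<lambda>v. t * h v) \<le> power_sum b \<alpha> h" if "t \<in> {0..1}" for t
  proof -
    have "ennreal (\<bar>t\<bar> powr \<alpha>) * power_sum b \<alpha> h \<le> 1 * power_sum b \<alpha> h"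
      using that \<alpha> powr_mono2[of \<alpha> t 1] by (intro mult_right_mono) auto
    then show ?thesis by (simp add: power_sum_scale)
  qed
  have scale_fields: "(\<lambda>v. t * h v) \<in> fields b" if "t \<in> {0..1}" for t
    using h scale_le[OF that] real by (intro fieldsI) (auto simp: fields_def intro: order_le_less_trans)
  have "continuous_on {0..1} (\<lambda>t. Psi b A (\<lambda>v. t * h v))"
    unfolding continuous_on_sequentially o_def
  proof safe
    fix t :: real and ts :: "nat \<Rightarrow> real"
    assume "t \<in> {0..1}" "\<forall>n. ts n \<in> {0..1}" "ts \<longlonglongrightarrow> t"
    then show "(\<lambda>n. Psi b A (\<lambda>v. ts n * h v)) \<longlonglongrightarrow> Psi b A (\<lambda>v. t * h v)"
      using real scale_le
      by (intro Psi_tendsto[where C = C] scale_fields tendsto_mult tendsto_const) auto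
  qed
  \<comment> \<open>The path starts at \<open>gauss_prob A\<close> for \<open>t = 0\<close> and ends
    at \<open>Psi b A h\<close> for \<open>t = 1\<close>, so the intermediate value theorem yields
    \<open>q\<close>.\<close>
  then obtain t where t: "t \<in> {0..1}" "Psi b A (\<lambda>v. t * h v) = q"
    using IVT'[of "\<lambda>t. Psi b A (\<lambda>v. t * h v)" 0 q 1] q by (auto simp: Psi_zero)
  have "Q_fun b lam \<alpha> A q \<le> energy b lam \<alpha> (\<lambda>v. t * h v)"
    using Q_fun_le_energy_self[OF scale_fields[OF t(1)]] t(2) by simp
  also have "\<dots> \<le> energy b lam \<alpha> h"
    unfolding energy_def by (intro mult_left_mono scale_le t) simp
  finally show ?thesis .
next
  case top
  then show ?thesis using lam by (simp add: energy_def ennreal_mult_top)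
qed

text \<open>Every competitor for \<open>q'\<close> can be scaled down to one for \<open>q\<close>
  without raising its energy.\<close>

lemma Q_fun_mono:
  assumes "gauss_prob A \<le> q" "q \<le> q'"
  shows "Q_fun b lam \<alpha> A q \<le> Q_fun b lam \<alpha> A q'"
  unfolding Q_fun_def[of b lam \<alpha> A q']
  using assms by (intro Inf_greatest) (auto intro!: Q_fun_le_energy)

lemma Q_fun_less_top:
  assumes "gauss_prob A \<le> q" "q < M_sup A"
  shows "Q_fun b lam \<alpha> A q < \<infinity>"
proof -
  obtain x where x: "q < g_fun A x" using assms(2) by (rule obtain_g_fun_greater)
  \<comment> \<open>With \<open>x\<close> at all children of the root and 0 elsewhere, every ray sum
    equals \<open>x\<close>, so \<open>Psi\<close> takes the value \<open>g_fun A x\<close>, and the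
    power sum is finite.\<close>
  define h where "h = (\<lambda>v. if v \<in> tree_level b 1 then x else 0)"
  have "power_sum b \<alpha> h = (\<Sum>v\<in>tree_level b 1. ennreal (\<bar>h v\<bar> powr \<alpha>))"
    unfolding power_sum_altdef using tree_level_Suc_subset[of b 0]
    by (intro nn_integral_count_space') (auto simp: h_def)
  then have fin: "power_sum b \<alpha> h < \<infinity>" by simp
  have h: "h \<in> fields b"
    using tree_level_Suc_subset[of b 0] by (intro fieldsI fin) (auto simp: h_def)
  have H: "H_sum h \<xi> = x" if "\<xi> \<in> space (boundary_measure b)" for \<xi>
  proof -
    have "(\<lambda>k. h (ray_prefix \<xi> (Suc k))) = (\<lambda>k. if k = 0 then x else 0)"
      using ray_prefix_in_tree_level[OF that, of 1] by (auto simp: h_def tree_level_def)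
    then show ?thesis
      unfolding H_sum_def by (simp add: sums_unique[OF sums_single, symmetric])
  qed
  interpret prob_space "boundary_measure b"
    using b by (intro prob_space_boundary_measure) simp
  have "Psi b A h = (LINT \<xi>|boundary_measure b. g_fun A x)"
    unfolding Psi_def by (intro Bochner_Integration.integral_cong) (auto simp: H)
  then have "Psi b A h = g_fun A x" by (simp add: prob_space)
  then have "Q_fun b lam \<alpha> A q \<le> energy b lam \<alpha> h"
    using x assms(1) by (intro Q_fun_le_energy h) auto
  also have "\<dots> < \<infinity>" using fin by (simp add: energy_less_top_iff del: infinity_ennreal_def)
  finally show ?thesis .
qed

section \<open>The right limit of the cost and the three assertions\<close>

definition approximable :: "real \<Rightarrow> bool" where
  "approximable p \<longleftrightarrow> (\<exists>h \<in> optimizers b lam \<alpha> A p. \<exists>hs :: nat \<Rightarrow> nat list \<Rightarrow> real.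
     (\<forall>n\<ge>1. hs n \<in> upper_fields b lam \<alpha> A p) \<and>
     (\<lambda>n. lnorm b \<alpha> (\<lambda>v. hs n v - h v)) \<longlonglongrightarrow> 0)"

context
  fixes p :: real
  assumes p: "gauss_prob A < p" "p < M_sup A"
begin

text \<open>By monotonicity the right limit exists and is the infimum over the values to the right;
  this identifies the \<open>Lim\<close> in \<open>Q_right\<close>.\<close>

lemma Q_fun_tendsto_INF:
  "(Q_fun b lam \<alpha> A \<longlongrightarrow> (INF q\<in>{p<..<M_sup A}. Q_fun b lam \<alpha> A q)) (at_right p)"
proof (rule order_tendstoI)
  have ev: "\<forall>\<^sub>F q in at_right p. q \<in> {p<..<q'}" if "p < q'" for q'
    using that by (rule eventually_at_right_real)
  let ?I = "INF q\<in>{p<..<M_sup A}. Q_fun b lam \<alpha> A q"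
  fix a
  show "\<forall>\<^sub>F q in at_right p. a < Q_fun b lam \<alpha> A q" if "a < ?I"
    using ev[OF p(2)] by eventually_elim (rule less_le_trans[OF that INF_lower])
  assume "?I < a"
  then obtain q' where q': "q' \<in> {p<..<M_sup A}" "Q_fun b lam \<alpha> A q' < a"
    by (auto simp: Inf_less_iff)
  then have "\<forall>\<^sub>F q in at_right p. q \<in> {p<..<q'}" by (intro ev) simp
  then show "\<forall>\<^sub>F q in at_right p. Q_fun b lam \<alpha> A q < a"
  proof eventually_elim
    case (elim q)
    then have "Q_fun b lam \<alpha> A q \<le> Q_fun b lam \<alpha> A q'" using p by (intro Q_fun_mono) auto
    then show ?case using q'(2) by (rule le_less_trans)
  qed
qed

lemma Q_right_eq_INF: "Q_right b lam \<alpha> A p = (INF q\<in>{p<..<M_sup A}. Q_fun b lam \<alpha> A q)"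
  unfolding Q_right_def using Q_fun_tendsto_INF by (intro tendsto_Lim) auto

lemma Q_fun_tendsto_Q_right: "(Q_fun b lam \<alpha> A \<longlongrightarrow> Q_right b lam \<alpha> A p) (at_right p)"
  using Q_fun_tendsto_INF by (simp add: Q_right_eq_INF)

lemma Q_fun_le_Q_right: "Q_fun b lam \<alpha> A p \<le> Q_right b lam \<alpha> A p"
  unfolding Q_right_eq_INF using p by (intro INF_greatest Q_fun_mono) auto

lemma Q_right_le_energy:
  assumes "h \<in> fields b" "p < Psi b A h"
  shows "Q_right b lam \<alpha> A p \<le> energy b lam \<alpha> h"
proof -
  \<comment> \<open>The minimum with the midpoint keeps \<open>q\<close> strictly below
    \<open>M_sup A\<close>, inside the range of the infimum, while \<open>q\<close> still exceeds
    \<open>p\<close> and is at most \<open>Psi b A h\<close>.\<close>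
  define q where "q = min (Psi b A h) ((p + M_sup A) / 2)"
  have "Q_right b lam \<alpha> A p \<le> Q_fun b lam \<alpha> A q"
    unfolding Q_right_eq_INF using assms p by (intro INF_lower) (auto simp: q_def min_def)
  also have "\<dots> \<le> energy b lam \<alpha> h"
    using assms p by (intro Q_fun_le_energy) (auto simp: q_def min_def)
  finally show ?thesis .
qed

lemma Q_right_eq_imp_approximable:
  assumes "Q_right b lam \<alpha> A p = Q_fun b lam \<alpha> A p"
  shows "approximable p"
proof -
  \<comment> \<open>The denominator is at least 2, which puts every \<open>q n\<close> strictly
    between \<open>p\<close> and \<open>M_sup A\<close>.\<close>
  define q where "q = (\<lambda>n. p + (M_sup A - p) / real (n + 2))"
  have q: "p < q n" "q n < M_sup A" for n
  proof -
    have "(M_sup A - p) / real (n + 2) < (M_sup A - p) / 1"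
      using p by (intro divide_strict_left_mono) auto
    then show "p < q n" "q n < M_sup A" using p by (auto simp: q_def)
  qed
  have "(\<lambda>n. p + (M_sup A - p) / real (n + 2)) \<longlonglongrightarrow> p + 0"
    by (intro tendsto_add tendsto_const LIMSEQ_ignore_initial_segment[of "\<lambda>n. (M_sup A - p) / real n"] lim_const_over_n)
  then have q_lim: "q \<longlonglongrightarrow> p" by (simp add: q_def)
  have "\<exists>h. h \<in> optimizers b lam \<alpha> A (q n)" for n
    using optimizers_nonempty[OF Q_fun_less_top] q[of n] p by (metis less_imp_le less_trans)
  then obtain hs where hs: "\<And>n. hs n \<in> optimizers b lam \<alpha> A (q n)" by metis
  have "filterlim q (at_right p) sequentially"
    using q_lim q(1) less_imp_neq[OF q(1), symmetric] by (simp add: filterlim_at)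
  \<comment> \<open>The optimal energies tend to the right limit, which by assumption is the cost at
    \<open>p\<close>.\<close>
  then have "(\<lambda>n. Q_fun b lam \<alpha> A (q n)) \<longlonglongrightarrow> Q_fun b lam \<alpha> A p"
    using filterlim_compose[OF Q_fun_tendsto_Q_right] assms by metis
  moreover have fin: "Q_fun b lam \<alpha> A p < \<infinity>" using p by (intro Q_fun_less_top) auto
  ultimately obtain r h where r: "strict_mono (r :: nat \<Rightarrow> nat)" "h \<in> optimizers b lam \<alpha> A p"
    "(\<lambda>n. power_sum b \<alpha> (\<lambda>v. hs (r n) v - h v)) \<longlonglongrightarrow> 0"
    using minimizing_sequence_compact[of hs p] hs q_lim by (auto simp: optimizers_def)
  have "hs n \<in> upper_fields b lam \<alpha> A p" for n
    using hs[of n] q[of n] Q_fun_less_top[of "q n"] p by (auto simp: optimizers_def upper_fields_def)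
  with r show ?thesis
    unfolding approximable_def
    by (intro bexI[of _ h] exI[of _ "\<lambda>n. hs (r n)"]) (simp_all add: lnorm_tendsto_0_iff[OF \<alpha>])
qed

text \<open>Every approximating field has energy at least \<open>Q_right b lam \<alpha> A p\<close>.
  Splitting it into \<open>h\<close> and a remainder, first \<open>n\<close> tends to infinity for
  fixed \<open>\<delta>\<close>, which removes the remainder, and then \<open>\<delta>\<close> tends
  to 0.\<close>

lemma approximable_imp_Q_right_eq:
  assumes "approximable p"
  shows "Q_right b lam \<alpha> A p = Q_fun b lam \<alpha> A p"
proof -
  obtain h hs where h: "h \<in> optimizers b lam \<alpha> A p"
    and hs: "\<And>n. n \<ge> 1 \<Longrightarrow> hs n \<in> upper_fields b lam \<alpha> A p"
    and lim: "(\<lambda>n. power_sum b \<alpha> (\<lambda>v. hs n v - h v)) \<longlonglongrightarrow> 0"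
    using assms unfolding approximable_def lnorm_tendsto_0_iff[OF \<alpha>] by blast
  have fin: "Q_fun b lam \<alpha> A p < \<infinity>" using p by (intro Q_fun_less_top) auto
  have le: "Q_right b lam \<alpha> A p \<le> ennreal ((1 + \<delta>) powr \<alpha>) * Q_fun b lam \<alpha> A p" if "\<delta> > 0" for \<delta>
  proof -
    define u where "u = (\<lambda>n. ennreal lam * (ennreal ((1 + \<delta>) powr \<alpha>) * power_sum b \<alpha> h +
        ennreal ((1 + 1 / \<delta>) powr \<alpha>) * power_sum b \<alpha> (\<lambda>v. hs n v - h v)))"
    have "u \<longlonglongrightarrow> ennreal lam * (ennreal ((1 + \<delta>) powr \<alpha>) * power_sum b \<alpha> h +
        ennreal ((1 + 1 / \<delta>) powr \<alpha>) * 0)"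
      unfolding u_def by (intro ennreal_tendsto_cmult tendsto_add tendsto_const lim) auto
    also have "ennreal lam * (ennreal ((1 + \<delta>) powr \<alpha>) * power_sum b \<alpha> h +
        ennreal ((1 + 1 / \<delta>) powr \<alpha>) * 0) = ennreal ((1 + \<delta>) powr \<alpha>) * Q_fun b lam \<alpha> A p"
    proof -
      have "ennreal lam * power_sum b \<alpha> h = Q_fun b lam \<alpha> A p"
        using h by (simp add: optimizers_def energy_def)
      from this[symmetric] show ?thesis by (simp add: mult.left_commute)
    qed
    finally have "u \<longlonglongrightarrow> ennreal ((1 + \<delta>) powr \<alpha>) * Q_fun b lam \<alpha> A p" .
    moreover have "Q_right b lam \<alpha> A p \<le> u n" if "n \<ge> 1" for n
    proof -
      have "Q_right b lam \<alpha> A p \<le> energy b lam \<alpha> (hs n)"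
        using hs[OF that] by (intro Q_right_le_energy) (auto simp: upper_fields_def)
      also have "\<dots> \<le> u n"
        unfolding energy_def u_def
        using power_sum_add_le[OF \<alpha> \<open>\<delta> > 0\<close>, of b h "\<lambda>v. hs n v - h v"] by (intro mult_left_mono) auto
      finally show ?thesis .
    qed
    ultimately show ?thesis by (intro LIMSEQ_le_const) auto
  qed
  have "(\<lambda>n. ennreal ((1 + 1 / real (Suc n)) powr \<alpha>) * Q_fun b lam \<alpha> A p) \<longlonglongrightarrow>
      ennreal ((1 + 0) powr \<alpha>) * Q_fun b lam \<alpha> A p"
    using fin
    by (intro tendsto_mult_ennreal tendsto_ennrealI tendsto_powr tendsto_add tendsto_const
        LIMSEQ_Suc[OF lim_const_over_n]) auto
  then have "(\<lambda>n. ennreal ((1 + 1 / real (Suc n)) powr \<alpha>) * Q_fun b lam \<alpha> A p) \<longlonglongrightarrow> Q_fun b lam \<alpha> A p"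
    by simp
  then have "Q_right b lam \<alpha> A p \<le> Q_fun b lam \<alpha> A p"
    by (rule LIMSEQ_le_const) (intro exI allI impI le, simp)
  with Q_fun_le_Q_right show ?thesis by (rule antisym[rotated])
qed

text \<open>The pairs that nearly attain the infimum involve varying optimizers. Compactness
  provides a single optimizer as their limit along a subsequence, and the quasi-triangle inequality
  carries the upper fields to it.\<close>

lemma rho_eq_0_imp_approximable:
  assumes "rho b lam \<alpha> A p = 0"
  shows "approximable p"
proof -
  have "\<exists>h h'. h \<in> optimizers b lam \<alpha> A p \<and> h' \<in> upper_fields b lam \<alpha> A p \<and>
      lnorm b \<alpha> (\<lambda>v. h' v - h v) < ennreal (1 / real (Suc n))" for n
  proof -
    have "rho b lam \<alpha> A p < ennreal (1 / real (Suc n))" using assms by simp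
    then show ?thesis unfolding rho_def Inf_less_iff by blast
  qed
  then obtain hs hs' where hs: "\<And>n. hs n \<in> optimizers b lam \<alpha> A p"
    and hs': "\<And>n. hs' n \<in> upper_fields b lam \<alpha> A p"
    and less: "\<And>n. lnorm b \<alpha> (\<lambda>v. hs' n v - hs n v) < ennreal (1 / real (Suc n))"
    by metis
  have fin: "Q_fun b lam \<alpha> A p < \<infinity>" using p by (intro Q_fun_less_top) auto
  have hs_fields: "hs n \<in> fields b" and "energy b lam \<alpha> (hs n) = Q_fun b lam \<alpha> A p"
    and "Psi b A (hs n) = p" for n
    using hs[of n] by (simp_all add: optimizers_def)
  then have "(\<lambda>n. energy b lam \<alpha> (hs n)) \<longlonglongrightarrow> Q_fun b lam \<alpha> A p" "(\<lambda>n. Psi b A (hs n)) \<longlonglongrightarrow> p"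
    by simp_all
  then obtain r h where r: "strict_mono (r :: nat \<Rightarrow> nat)" and h: "h \<in> optimizers b lam \<alpha> A p"
    and lim: "(\<lambda>n. power_sum b \<alpha> (\<lambda>v. hs (r n) v - h v)) \<longlonglongrightarrow> 0"
    using minimizing_sequence_compact[of hs p, OF hs_fields _ fin] by blast
  have "(\<lambda>n. lnorm b \<alpha> (\<lambda>v. hs' n v - hs n v)) \<longlonglongrightarrow> 0"
  proof (rule tendsto_sandwich[OF _ _ tendsto_const])
    have "(\<lambda>n. ennreal (1 / real (Suc n))) \<longlonglongrightarrow> ennreal 0"
      by (intro tendsto_ennrealI LIMSEQ_Suc[OF lim_const_over_n])
    then show "(\<lambda>n. ennreal (1 / real (Suc n))) \<longlonglongrightarrow> 0" by simp
  qed (auto intro!: always_eventually less_imp_le less simp del: of_nat_Suc)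
  then have lim': "(\<lambda>n. power_sum b \<alpha> (\<lambda>v. hs' (r n) v - hs (r n) v)) \<longlonglongrightarrow> 0"
    unfolding lnorm_tendsto_0_iff[OF \<alpha>] using LIMSEQ_subseq_LIMSEQ[OF _ r] by (fastforce simp: o_def)
  have "(\<lambda>n. power_sum b \<alpha> (\<lambda>v. hs' (r n) v - h v)) \<longlonglongrightarrow> 0"
  proof (rule tendsto_sandwich[OF _ _ tendsto_const])
    define u where "u = (\<lambda>n. ennreal (2 powr \<alpha>) * power_sum b \<alpha> (\<lambda>v. hs' (r n) v - hs (r n) v) +
        ennreal (2 powr \<alpha>) * power_sum b \<alpha> (\<lambda>v. hs (r n) v - h v))"
    have "u \<longlonglongrightarrow> ennreal (2 powr \<alpha>) * 0 + ennreal (2 powr \<alpha>) * 0"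
      unfolding u_def by (intro tendsto_add ennreal_tendsto_cmult lim lim') auto
    then show "u \<longlonglongrightarrow> 0" by simp
    show "\<forall>\<^sub>F n in sequentially. power_sum b \<alpha> (\<lambda>v. hs' (r n) v - h v) \<le> u n"
    proof (intro always_eventually allI)
      fix n
      show "power_sum b \<alpha> (\<lambda>v. hs' (r n) v - h v) \<le> u n"
        using power_sum_add_le[OF \<alpha>, of 1 b "\<lambda>v. hs' (r n) v - hs (r n) v" "\<lambda>v. hs (r n) v - h v"]
        by (simp add: u_def)
    qed
  qed simp
  with h hs' show ?thesis
    unfolding approximable_def
    by (intro bexI[of _ h] exI[of _ "\<lambda>n. hs' (r n)"]) (simp_all add: lnorm_tendsto_0_iff[OF \<alpha>])
qed

lemma approximable_imp_rho_eq_0: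
  assumes "approximable p"
  shows "rho b lam \<alpha> A p = 0"
proof -
  obtain h hs where h: "h \<in> optimizers b lam \<alpha> A p"
    and hs: "\<And>n. n \<ge> 1 \<Longrightarrow> hs n \<in> upper_fields b lam \<alpha> A p"
    and lim: "(\<lambda>n. lnorm b \<alpha> (\<lambda>v. hs n v - h v)) \<longlonglongrightarrow> 0"
    using assms unfolding approximable_def by blast
  have "rho b lam \<alpha> A p \<le> lnorm b \<alpha> (\<lambda>v. hs n v - h v)" if "n \<ge> 1" for n
    unfolding rho_def using h hs[OF that] by (intro Inf_lower) blast
  then have "rho b lam \<alpha> A p \<le> 0"
    using lim by (intro LIMSEQ_le_const) auto
  then show ?thesis by simp
qed

end

end

section \<open>Lipschitz continuity of the shifted Gaussian probability\<close>

lemma interval_with_endpoints_borel: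
  assumes "interval_with_endpoints a c I"
  shows "I \<in> sets borel"
proof -
  define U where "U = {x. a < ereal x \<and> ereal x < c}"
  \<comment> \<open>An infinite endpoint is sent to the default 0, which only enlarges the finite
    set on the right.\<close>
  have "I - U \<subseteq> {real_of_ereal a, real_of_ereal c}"
  proof
    fix x assume "x \<in> I - U"
    then have "a = ereal x \<or> c = ereal x"
      using assms unfolding interval_with_endpoints_def U_def by force
    then show "x \<in> {real_of_ereal a, real_of_ereal c}" by auto
  qed
  then have "finite (I - U)" by (rule finite_subset) simp
  then have "I - U \<in> sets borel" by (intro borel_closed finite_imp_closed)
  moreover have "U \<in> sets borel" unfolding U_def by measurable
  moreover have "I = U \<union> (I - U)"
    using assms unfolding interval_with_endpoints_def U_def by blast
  ultimately show ?thesis by (metis sets.Un)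
qed

text \<open>The density is at most 1 / sqrt (2 pi), hence at most 1.\<close>

lemma emeasure_std_normal_le:
  assumes "B \<in> sets borel"
  shows "emeasure std_normal_distribution B \<le> emeasure lborel B"
proof -
  have "std_normal_density x \<le> 1" for x
  proof -
    have "exp (- x\<^sup>2 / 2) \<le> 1" by simp
    moreover have "1 / sqrt (2 * pi) \<le> 1"
      using pi_ge_two by (simp add: real_le_rsqrt)
    ultimately have "1 / sqrt (2 * pi) * exp (- x\<^sup>2 / 2) \<le> 1 * 1"
      by (intro mult_mono) auto
    then show ?thesis by (simp add: std_normal_density_def)
  qed
  then have le: "ennreal (std_normal_density x) * indicator B x \<le> indicator B x" for x
    by (auto simp: indicator_def ennreal_le_1)
  have "emeasure std_normal_distribution B = (\<integral>\<^sup>+x. ennreal (std_normal_density x) * indicator B x \<partial>lborel)"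
    using assms by (intro emeasure_density) auto
  also have "\<dots> \<le> (\<integral>\<^sup>+x. indicator B x \<partial>lborel)"
    by (intro nn_integral_mono le)
  finally show ?thesis using assms by simp
qed

lemma mem_shift_set_iff: "z \<in> shift_set A x \<longleftrightarrow> z + x \<in> A"
  unfolding shift_set_def by (auto intro: exI[of _ "z + x"])

lemma shift_set_borel: "A \<in> sets borel \<Longrightarrow> shift_set A x \<in> sets borel"
proof -
  assume A: "A \<in> sets borel"
  have "shift_set A x = (\<lambda>z. z + x) -` A \<inter> space borel"
    by (auto simp: mem_shift_set_iff)
  also have "\<dots> \<in> sets borel" using A by (rule measurable_sets[rotated]) measurable
  finally show ?thesis .
qed

text \<open>Translation uncovers a strip of length \<open>\<bar>x - y\<bar>\<close> at one end only:
  the right end for \<open>x < y\<close>, the left end for \<open>y < x\<close>. If that end is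
  infinite the difference is empty, so the default value in \<open>s\<close> does no harm.\<close>

lemma shift_set_interval_diff_subset:
  assumes "interval_with_endpoints a c I"
  obtains s where "shift_set I x - shift_set I y \<subseteq> {s - \<bar>x - y\<bar>..s}"
proof (cases "x \<le> y")
  case True
  show ?thesis
  proof (rule that[of "real_of_ereal c - x"], rule subsetI)
    fix z assume z: "z \<in> shift_set I x - shift_set I y"
    then have "a \<le> ereal (z + x)" "ereal (z + x) \<le> c" "\<not> (a < ereal (z + y) \<and> ereal (z + y) < c)"
      using assms unfolding interval_with_endpoints_def by (auto simp: mem_shift_set_iff)
    \<comment> \<open>Strictness matters when \<open>z + x\<close> is the left endpoint: then
      \<open>z + y\<close> lies strictly beyond it, and so \<open>z + y\<close> can only have left
      the interval at the right end.\<close>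
    moreover have "x < y" using True z by (cases "x = y") auto
    ultimately show "z \<in> {real_of_ereal c - x - \<bar>x - y\<bar>..real_of_ereal c - x}"
      by (cases a; cases c) auto
  qed
next
  case False
  show ?thesis
  proof (rule that[of "real_of_ereal a - y"], rule subsetI)
    fix z assume z: "z \<in> shift_set I x - shift_set I y"
    then have "a \<le> ereal (z + x)" "ereal (z + x) \<le> c" "\<not> (a < ereal (z + y) \<and> ereal (z + y) < c)"
      using assms unfolding interval_with_endpoints_def by (auto simp: mem_shift_set_iff)
    with False show "z \<in> {real_of_ereal a - y - \<bar>x - y\<bar>..real_of_ereal a - y}"
      by (cases a; cases c) auto
  qed
qed

text \<open>Each interval contributes a strip of Gaussian mass at most
  \<open>\<bar>x - y\<bar>\<close>, and the union bound adds these up. Exchanging \<open>x\<close>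
  and \<open>y\<close> gives the other direction.\<close>

lemma g_fun_lipschitz:
  fixes lo hi :: "'i \<Rightarrow> ereal"
  assumes "finite F" and I: "\<And>j. j \<in> F \<Longrightarrow> interval_with_endpoints (lo j) (hi j) (J j)"
  shows "(real (card F))-lipschitz_on UNIV (g_fun (\<Union>j\<in>F. J j))"
proof -
  let ?N = std_normal_distribution
  let ?A = "\<Union>j\<in>F. J j"
  interpret N: prob_space ?N by (rule prob_space_normal_density) simp
  have A: "?A \<in> sets borel"
    using assms by (intro sets.finite_UN) (auto intro: interval_with_endpoints_borel)
  have le: "g_fun ?A x - g_fun ?A y \<le> real (card F) * \<bar>x - y\<bar>" for x y
  proof -
    have "\<exists>s. \<forall>j\<in>F. shift_set (J j) x - shift_set (J j) y \<subseteq> {s j - \<bar>x - y\<bar>..s j}"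
      by (intro bchoice ballI) (meson shift_set_interval_diff_subset I)
    then obtain s where s: "\<And>j. j \<in> F \<Longrightarrow> shift_set (J j) x - shift_set (J j) y \<subseteq> {s j - \<bar>x - y\<bar>..s j}"
      by blast
    have small: "N.prob {t - \<bar>x - y\<bar>..t} \<le> \<bar>x - y\<bar>" for t
    proof -
      have "emeasure ?N {t - \<bar>x - y\<bar>..t} \<le> ennreal \<bar>x - y\<bar>"
        using emeasure_std_normal_le[of "{t - \<bar>x - y\<bar>..t}"] by simp
      then show ?thesis by (simp add: N.emeasure_eq_measure)
    qed
    have sub: "shift_set ?A x - shift_set ?A y \<subseteq> (\<Union>j\<in>F. {s j - \<bar>x - y\<bar>..s j})"
      using s by (fastforce simp: mem_shift_set_iff)
    have "g_fun ?A x \<le> N.prob (shift_set ?A y \<union> (\<Union>j\<in>F. {s j - \<bar>x - y\<bar>..s j}))"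
      unfolding g_fun_def gauss_prob_def using sub assms(1) shift_set_borel[OF A]
      by (intro N.finite_measure_mono) (auto intro!: sets.Un sets.finite_UN)
    also have "\<dots> \<le> g_fun ?A y + N.prob (\<Union>j\<in>F. {s j - \<bar>x - y\<bar>..s j})"
      unfolding g_fun_def gauss_prob_def using assms(1) shift_set_borel[OF A]
      by (intro measure_Un_le) (auto intro!: sets.finite_UN)
    also have "N.prob (\<Union>j\<in>F. {s j - \<bar>x - y\<bar>..s j}) \<le> (\<Sum>j\<in>F. N.prob {s j - \<bar>x - y\<bar>..s j})"
      using assms(1) by (intro N.finite_measure_subadditive_finite) auto
    also have "\<dots> \<le> (\<Sum>j\<in>F. \<bar>x - y\<bar>)" by (intro sum_mono small)
    finally show ?thesis by simp
  qed
  show ?thesis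
  proof (rule lipschitz_onI)
    fix x y :: real
    show "dist (g_fun ?A x) (g_fun ?A y) \<le> real (card F) * dist x y"
      using le[of x y] le[of y x] by (auto simp: dist_real_def abs_le_iff abs_minus_commute)
  qed simp
qed

theorem theorem4p1:
  fixes b r :: nat and lam \<alpha> p :: real and A :: "real set"
    and lo hi :: "nat \<Rightarrow> ereal" and J :: "nat \<Rightarrow> real set"
  assumes "b \<ge> 2" and "lam > 0"
    and "A \<noteq> {}" and "A \<noteq> UNIV"
    and "r \<ge> 1"
    and "\<And>j. j \<in> {1..r} \<Longrightarrow> lo j < hi j"
    and "\<And>j. j \<in> {1..r} \<Longrightarrow> interval_with_endpoints (lo j) (hi j) (J j)"
    and "disjoint_family_on J {1..r}"
    and "A = (\<Union>j\<in>{1..r}. J j)"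
    and "\<alpha> > 0"
    and "p \<in> {gauss_prob A<..<M_sup A}"
  shows "(Q_right b lam \<alpha> A p = Q_fun b lam \<alpha> A p \<longleftrightarrow> rho b lam \<alpha> A p = 0) \<and>
    (rho b lam \<alpha> A p = 0 \<longleftrightarrow>
      (\<exists>h \<in> optimizers b lam \<alpha> A p. \<exists>hs :: nat \<Rightarrow> nat list \<Rightarrow> real.
        (\<forall>n\<ge>1. hs n \<in> upper_fields b lam \<alpha> A p) \<and>
        (\<lambda>n. lnorm b \<alpha> (\<lambda>v. hs n v - h v)) \<longlonglongrightarrow> 0))"
proof -
  interpret lipschitz_tree b lam \<alpha> "real (card {1..r})" A
    using g_fun_lipschitz[of "{1..r}" lo hi J] assms by unfold_locales auto
  from assms(11) have p: "gauss_prob A < p" "p < M_sup A" by auto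
  show ?thesis
    \<comment> \<open>Assertions (i) and (ii) are each equivalent to (iii).\<close>
    using Q_right_eq_imp_approximable[OF p] approximable_imp_Q_right_eq[OF p]
      rho_eq_0_imp_approximable[OF p] approximable_imp_rho_eq_0[OF p]
    unfolding approximable_def by blast
qed

end
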